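(* Let $G$ be a subgroup of $\mathbb{Q}^d$ for some integer $d\geq 1$, let $R$ be a Noetherian $G$-graded ring and $M$ a finitely generated modest $G$-graded $R$-module with Hilbert series $HS(z)$. Then there exist finitely many nonzero elements $v_1,\ldots,v_s\in G$ such that $HS(z)\prod_{i}(1-z^{v_i})$ is a Laurent polynomial, i.e. an element of $\mathbb{Z}[\mathbb{Q}^d]$. That is, the Hilbert series of $M$ is summable.
   Context: All rings are commutative with identity. A $G$-graded ring is $R=\bigoplus_{g\in G}R_g$ with $R_gR_h\subset R_{g+h}$; a $G$-graded $R$-module is $M=\bigoplus_{g\in G}M_g$ with $R_gM_h\subset M_{g+h}$. $M$ is modest if the length $\ell_{R_0}(M_g)$ is finite for every $g\in G$. $\mathbb{Z}[\mathbb{Q}^d]$ is the ring of finite sums $\sum_{t\in\mathbb{Q}^d}a_tz^t$ with $a_t\in\mathbb{Z}$, $z^t=z_1^{t_1}\cdots z_d^{t_d}$ (Laurent polynomials with rational exponents). $\mathbb{Z}[[\mathbb{Q}^d]]$ is the additive group of all formal (possibly infinite) sums $\sum_{t\in\mathbb{Q}^d}a_tz^t$, $a_t\in\mathbb{Z}$; it is a module over $\mathbb{Z}[\mathbb{Q}^d]$, in particular over $\mathbb{Z}[z,z^{-1}]=\mathbb{Z}[z_1^{\pm1},\ldots,z_d^{\pm1}]$. The Hilbert series of a modest module $M$ is $HS(z)=\sum_{t\in\mathbb{Q}^d}\ell_{R_0}(M_t)z^t\in\mathbb{Z}[[\mathbb{Q}^d]]$, where $M_t=0$ for $t\notin G$.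 An element $a(z)\in\mathbb{Z}[[\mathbb{Q}^d]]$ is summable if there exists a nonzero $b(z)\in\mathbb{Z}[z,z^{-1}]$ with $a(z)b(z)\in\mathbb{Z}[\mathbb{Q}^d]$. The empty product ($s=0$) is allowed. *)

theory Defs
  imports
    "HOL-Analysis.Finite_Cartesian_Product"
    "HOL-Library.Extended_Nat"
    "HOL-Library.Poly_Mapping"
    "HOL-Algebra.AbelCoset"
    "HOL-Algebra.Module"
    "HOL-Algebra.Ring_Divisibility"
begin

section \<open>Graded rings and modules\<close>

definition rat_vec_group :: "(rat ^ 'd) monoid" where
  "rat_vec_group = \<lparr>carrier = UNIV, monoid.mult = (+), one = 0\<rparr>"

text \<open>
  Internal direct sum \<open>A = \<Oplus>\<^bsub>g\<in>G\<^esub> A\<^sub>g\<close> of an abelian group.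
  The values of \<open>C\<close> outside \<open>G\<close> are irrelevant; \<open>f\<close> is forced to
  be zero there only in order to make it unique as a HOL function.
\<close>

definition internal_direct_sum ::
    "('a, 'm) ring_scheme \<Rightarrow> 'i set \<Rightarrow> ('i \<Rightarrow> 'a set) \<Rightarrow> bool" where
  "internal_direct_sum A G C \<longleftrightarrow>
     (\<forall>g\<in>G. additive_subgroup (C g) A) \<and>
     (\<forall>x\<in>carrier A. \<exists>!f.
        (\<forall>g\<in>G. f g \<in> C g) \<and> (\<forall>g. g \<notin> G \<longrightarrow> f g = \<zero>\<^bsub>A\<^esub>) \<and>
        finite {g. f g \<noteq> \<zero>\<^bsub>A\<^esub>} \<and> x = finsum A f {g. f g \<noteq> \<zero>\<^bsub>A\<^esub>})"

definition graded_ring ::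
    "'g::ab_group_add set \<Rightarrow> ('r, 'x) ring_scheme \<Rightarrow> ('g \<Rightarrow> 'r set) \<Rightarrow> bool" where
  "graded_ring G R Rg \<longleftrightarrow>
     cring R \<and> internal_direct_sum R G Rg \<and>
     (\<forall>g\<in>G. \<forall>h\<in>G. \<forall>a\<in>Rg g. \<forall>b\<in>Rg h. a \<otimes>\<^bsub>R\<^esub> b \<in> Rg (g + h))"

definition graded_module ::
    "'g::ab_group_add set \<Rightarrow> ('r, 'x) ring_scheme \<Rightarrow> ('g \<Rightarrow> 'r set) \<Rightarrow>
     ('r, 'm, 'y) module_scheme \<Rightarrow> ('g \<Rightarrow> 'm set) \<Rightarrow> bool" where
  "graded_module G R Rg M Mg \<longleftrightarrow>
     Module.module R M \<and> internal_direct_sum M G Mg \<and>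
     (\<forall>g\<in>G. \<forall>h\<in>G. \<forall>a\<in>Rg g. \<forall>x\<in>Mg h. a \<odot>\<^bsub>M\<^esub> x \<in> Mg (g + h))"

definition finitely_generated_module ::
    "('r, 'x) ring_scheme \<Rightarrow> ('r, 'm, 'y) module_scheme \<Rightarrow> bool" where
  "finitely_generated_module R M \<longleftrightarrow>
     (\<exists>S. finite S \<and> S \<subseteq> carrier M \<and>
        (\<forall>x\<in>carrier M. \<exists>a\<in>S \<rightarrow> carrier R. x = (\<Oplus>\<^bsub>M\<^esub>s\<in>S. a s \<odot>\<^bsub>M\<^esub> s)))"

text \<open>The length of a module: the supremum of the lengths of strict chains of submodules.\<close>

definition module_length ::
    "('r, 'x) ring_scheme \<Rightarrow> ('r, 'm, 'y) module_scheme \<Rightarrow> enat" where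
  "module_length R M =
     Sup {enat n |n. \<exists>N :: nat \<Rightarrow> 'm set.
            (\<forall>i\<le>n. submodule (N i) R M) \<and> (\<forall>i<n. N i \<subset> N (Suc i))}"

definition component_length ::
    "('r, 'x) ring_scheme \<Rightarrow> ('g::ab_group_add \<Rightarrow> 'r set) \<Rightarrow>
     ('r, 'm, 'y) module_scheme \<Rightarrow> ('g \<Rightarrow> 'm set) \<Rightarrow> 'g \<Rightarrow> enat" where
  "component_length R Rg M Mg g =
     module_length (R\<lparr>carrier := Rg 0\<rparr>) (M\<lparr>carrier := Mg g\<rparr>)"

definition modest ::
    "'g::ab_group_add set \<Rightarrow> ('r, 'x) ring_scheme \<Rightarrow> ('g \<Rightarrow> 'r set) \<Rightarrow>
     ('r, 'm, 'y) module_scheme \<Rightarrow> ('g \<Rightarrow> 'm set) \<Rightarrow> bool" where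
  "modest G R Rg M Mg \<longleftrightarrow> (\<forall>g\<in>G. component_length R Rg M Mg g \<noteq> \<infinity>)"


section \<open>Laurent polynomials and series with rational exponents\<close>

text \<open>
  \<open>\<int>[\<rat>\<^sup>d]\<close> is the type of finitely supported functions, whose multiplication in the
  library is convolution; \<open>\<int>[[\<rat>\<^sup>d]]\<close> is the type of all functions.
\<close>

type_synonym 'd laurent_poly = "(rat ^ 'd) \<Rightarrow>\<^sub>0 int"
type_synonym 'd laurent_series = "rat ^ 'd \<Rightarrow> int"

abbreviation zpow :: "rat ^ 'd \<Rightarrow> 'd::finite laurent_poly" where
  "zpow v \<equiv> Poly_Mapping.single v 1"

text \<open>The action of \<open>\<int>[\<rat>\<^sup>d]\<close> on \<open>\<int>[[\<rat>\<^sup>d]]\<close>: the coefficient of \<open>z\<^sup>t\<close> in \<open>b(z) a(z)\<close>.\<close>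

definition act :: "'d::finite laurent_poly \<Rightarrow> 'd laurent_series \<Rightarrow> 'd laurent_series" where
  "act b a = (\<lambda>t. \<Sum>u\<in>Poly_Mapping.keys b. Poly_Mapping.lookup b u * a (t - u))"

definition is_laurent_poly :: "'d::finite laurent_series \<Rightarrow> bool" where
  "is_laurent_poly a \<longleftrightarrow> (\<exists>p :: 'd laurent_poly. a = Poly_Mapping.lookup p)"

definition integral_exponents :: "'d::finite laurent_poly \<Rightarrow> bool" where
  "integral_exponents b \<longleftrightarrow> (\<forall>u\<in>Poly_Mapping.keys b. \<forall>i. u $ i \<in> \<int>)"

definition summable_series :: "'d::finite laurent_series \<Rightarrow> bool" where
  "summable_series a \<longleftrightarrow>
     (\<exists>b :: 'd laurent_poly. b \<noteq> 0 \<and> integral_exponents b \<and> is_laurent_poly (act b a))"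

text \<open>\<^const>\<open>the_enat\<close> is only meaningful for finite lengths, i.e. for modest modules.\<close>

definition hilbert_series ::
    "(rat ^ 'd) set \<Rightarrow> ('r, 'x) ring_scheme \<Rightarrow> (rat ^ 'd \<Rightarrow> 'r set) \<Rightarrow>
     ('r, 'm, 'y) module_scheme \<Rightarrow> (rat ^ 'd \<Rightarrow> 'm set) \<Rightarrow> 'd::finite laurent_series" where
  "hilbert_series G R Rg M Mg =
     (\<lambda>t. if t \<in> G then int (the_enat (component_length R Rg M Mg t)) else 0)"

end

theory Submission
  imports Defs
begin

text \<open>
  The proof is a Noetherian induction that needs neither generators of \<open>R\<close> over \<open>R\<^sub>0\<close> nor prime
  filtrations. For a graded submodule \<open>N\<close> and a homogeneous \<open>m\<close> consider \<open>(N + R m) / N\<close>, which up to a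
  shift is \<open>R / I\<close> with \<open>I = (N : m)\<close>. If \<open>R\<^sub>v \<subseteq> I\<close> for all \<open>v \<noteq> 0\<close>, its Hilbert series is a monomial.
  Otherwise pick \<open>a \<in> R\<^sub>v - I\<close> with \<open>v \<noteq> 0\<close> and insert \<open>N + R a m\<close> between \<open>N\<close> and \<open>N + R m\<close>. The upper
  quotient is a shift of \<open>R / (I + R a)\<close>, the lower one of \<open>R / (I : a)\<close>. Either \<open>(I : a)\<close> is larger than
  \<open>I\<close> as well, or the lower quotient is the whole one shifted by \<open>v\<close>, so that \<open>1 - z\<^sup>v\<close> times the Hilbert
  series is the one of the upper quotient.
  Homogeneous generators of \<open>M\<close> are adjoined one at a time, starting from \<open>N = 0\<close>. Since
  \<open>1 - z\<^sup>v\<close> divides \<open>1 - z\<^sup>n\<^sup>v\<close>, the exponents can finally be made integral.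
\<close>

section \<open>Chains of submodules\<close>

text \<open>A strict chain of \<open>n\<close> inclusions inside \<open>S\<close> that ends exactly
  at \<open>X\<close>, while its lowest member only has to contain \<open>A\<close>. This slack at
  the bottom lets chains be mapped, glued and cut without adjusting end points. When
  \<open>S\<close> describes submodules, the greatest possible \<open>n\<close> is the length of
  \<open>X / A\<close>.\<close>

inductive chain_to :: "('a set \<Rightarrow> bool) \<Rightarrow> 'a set \<Rightarrow> 'a set \<Rightarrow> nat \<Rightarrow> bool"
  for S :: "'a set \<Rightarrow> bool" and A :: "'a set"
  where
    base: "S X \<Longrightarrow> A \<subseteq> X \<Longrightarrow> chain_to S A X 0"
  | step: "chain_to S A X n \<Longrightarrow> X \<subset> Y \<Longrightarrow> S Y \<Longrightarrow> chain_to S A Y (Suc n)"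

lemma chain_to_sub: "chain_to S A X n \<Longrightarrow> S X \<and> A \<subseteq> X"
  by (induction rule: chain_to.induct) auto

text \<open>Only the last member is exchanged: a strict inclusion into it stays strict when it is
  enlarged.\<close>

lemma chain_to_mono_top:
  assumes "chain_to S A X n" "X \<subseteq> Y" "S Y"
  shows "chain_to S A Y n"
  using assms
proof cases
  case base
  then show ?thesis using assms by (auto intro: chain_to.base)
next
  case (step X' n')
  then show ?thesis using assms by (blast intro: chain_to.step)
qed

text \<open>The lowest member of the upper chain contains \<open>B\<close>, so the lower chain can
  be moved up to end there; the remaining steps are then appended.\<close>

lemma chain_to_concat:
  assumes "chain_to S B Y q" "chain_to S A B p"
  shows "chain_to S A Y (p + q)"
  using assms
proof (induction rule: chain_to.induct)
  case (base X)
  then show ?case by (auto intro: chain_to_mono_top)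
next
  case (step X n Y)
  then show ?case by (auto intro: chain_to.step)
qed

text \<open>Transfer principle for comparing lengths: a map that is strictly monotone between
  \<open>A\<close> and \<open>B\<close> preserves the number of steps.\<close>

lemma chain_to_map:
  assumes "chain_to S A X n" "X \<subseteq> B"
    and "\<And>Y. S Y \<Longrightarrow> A \<subseteq> Y \<Longrightarrow> Y \<subseteq> B \<Longrightarrow> S' (\<phi> Y) \<and> A' \<subseteq> \<phi> Y"
    and "\<And>Y Z. S Y \<Longrightarrow> S Z \<Longrightarrow> A \<subseteq> Y \<Longrightarrow> Y \<subset> Z \<Longrightarrow> Z \<subseteq> B \<Longrightarrow> \<phi> Y \<subset> \<phi> Z"
  shows "chain_to S' A' (\<phi> X) n"
  using assms(1,2)
proof (induction rule: chain_to.induct)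
  case (base X)
  then show ?case using assms(3)[of X] by (intro chain_to.base) auto
next
  case (step X n Y)
  have "A \<subseteq> X" "S X" using chain_to_sub[OF step.hyps(1)] by auto
  then show ?case using step assms(3)[of Y] assms(4)[of X Y]
    by (intro chain_to.step[of _ _ "\<phi> X"]) auto
qed

text \<open>The harder half of the additivity of length, with \<open>f X\<close> in the place of
  \<open>X + B\<close>. By the modular law a strict step from \<open>X\<close> to \<open>Y\<close>
  is strict on the intersections with \<open>B\<close> or on the images under \<open>f\<close>, so
  each step is counted in \<open>p\<close> or in \<open>q\<close>.\<close>

lemma chain_to_split:
  assumes "chain_to S A X n" "S B" "A \<subseteq> B"
    and inter: "\<And>X. S X \<Longrightarrow> S (X \<inter> B)"
    and join: "\<And>X. S X \<Longrightarrow> S (f X) \<and> B \<subseteq> f X"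
    and mono: "\<And>X Y. X \<subseteq> Y \<Longrightarrow> f X \<subseteq> f Y"
    and modular: "\<And>X Y. S X \<Longrightarrow> S Y \<Longrightarrow> X \<subseteq> Y \<Longrightarrow> X \<inter> B = Y \<inter> B \<Longrightarrow> f X = f Y \<Longrightarrow> X = Y"
  shows "\<exists>p q. n \<le> p + q \<and> chain_to S A (X \<inter> B) p \<and> chain_to S B (f X) q"
  using assms(1)
proof (induction rule: chain_to.induct)
  case (base X)
  have "chain_to S A (X \<inter> B) 0" "chain_to S B (f X) 0"
    using base inter join assms(3) by (auto intro!: chain_to.base)
  then show ?case by blast
next
  case (step X n Y)
  then obtain p q where pq: "n \<le> p + q" "chain_to S A (X \<inter> B) p" "chain_to S B (f X) q"
    by blast
  have SX: "S X" using chain_to_sub[OF step.hyps(1)] by auto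
  have le: "X \<inter> B \<subseteq> Y \<inter> B" "f X \<subseteq> f Y" using step.hyps mono by auto
  have p': "chain_to S A (Y \<inter> B) p" and q': "chain_to S B (f Y) q"
    using pq le step.hyps inter join by (auto intro: chain_to_mono_top)
  show ?case
  proof (cases "X \<inter> B = Y \<inter> B")
    case True
    then have "f X \<subset> f Y" using modular[OF SX, of Y] step.hyps le by auto
    then have "chain_to S B (f Y) (Suc q)" using pq step.hyps join by (auto intro: chain_to.step)
    then show ?thesis using p' pq(1) by (intro exI[of _ p] exI[of _ "Suc q"]) auto
  next
    case False
    then have "chain_to S A (Y \<inter> B) (Suc p)" using pq step.hyps inter le
      by (intro chain_to.step[of _ _ "X \<inter> B"]) auto
    then show ?thesis using q' pq(1) by (intro exI[of _ "Suc p"] exI[of _ q]) auto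
  qed
qed

text \<open>If all members of \<open>S\<close> contain \<open>A\<close>, the condition on the lowest
  member holds automatically. This links \<open>chain_to\<close> to the sequences in
  \<open>module_length\<close>.\<close>

lemma chain_to_iff_sequence:
  assumes "\<And>X. S X \<Longrightarrow> A \<subseteq> X"
  shows "(\<exists>X. chain_to S A X n) \<longleftrightarrow> (\<exists>N. (\<forall>i\<le>n. S (N i)) \<and> (\<forall>i<n. N i \<subset> N (Suc i)))"
proof
  assume "\<exists>X. chain_to S A X n"
  then obtain X where "chain_to S A X n" by blast
  then have "\<exists>N. (\<forall>i\<le>n. S (N i)) \<and> (\<forall>i<n. N i \<subset> N (Suc i)) \<and> N n = X"
  proof (induction rule: chain_to.induct)
    case (base X)
    then show ?case by auto
  next
    case (step X n Y)
    then obtain N where "\<forall>i\<le>n. S (N i)" "\<forall>i<n. N i \<subset> N (Suc i)" "N n = X" by blast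
    then show ?case using step.hyps
      by (intro exI[of _ "N(Suc n := Y)"]) (auto simp: le_Suc_eq less_Suc_eq)
  qed
  then show "\<exists>N. (\<forall>i\<le>n. S (N i)) \<and> (\<forall>i<n. N i \<subset> N (Suc i))" by blast
next
  assume "\<exists>N. (\<forall>i\<le>n. S (N i)) \<and> (\<forall>i<n. N i \<subset> N (Suc i))"
  then obtain N where N: "\<forall>i\<le>n. S (N i)" "\<forall>i<n. N i \<subset> N (Suc i)" by blast
  have "chain_to S A (N k) k" if "k \<le> n" for k
    using that
  proof (induction k)
    case 0
    then show ?case using N assms by (intro chain_to.base) auto
  next
    case (Suc k)
    then show ?case using N by (intro chain_to.step[of _ _ "N k"]) auto
  qed
  then show "\<exists>X. chain_to S A X n" by blast
qed

text \<open>A natural number, so that differences of series make sense. \<open>Max\<close> is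
  meaningful only for a finite nonempty set: finiteness comes from \<open>bounded_chains\<close>,
  and the chain of length 0 exists as soon as \<open>S B\<close> and
  \<open>A \<subseteq> B\<close>.\<close>

definition chain_length :: "('a set \<Rightarrow> bool) \<Rightarrow> 'a set \<Rightarrow> 'a set \<Rightarrow> nat" where
  "chain_length S A B = Max {n. chain_to S A B n}"

definition bounded_chains :: "('a set \<Rightarrow> bool) \<Rightarrow> bool" where
  "bounded_chains S \<longleftrightarrow> (\<exists>K. \<forall>A B n. chain_to S A B n \<longrightarrow> n \<le> K)"

lemma chain_length_ge:
  assumes "bounded_chains S" "chain_to S A B n"
  shows "n \<le> chain_length S A B"
proof -
  from assms(1) have "finite {n. chain_to S A B n}"
    unfolding bounded_chains_def by (auto simp: finite_nat_set_iff_bounded_le)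
  then show ?thesis unfolding chain_length_def using assms(2) by (auto intro: Max_ge)
qed

lemma chain_length_attained:
  assumes "bounded_chains S" "S B" "A \<subseteq> B"
  shows "chain_to S A B (chain_length S A B)"
proof -
  from assms(1) have "finite {n. chain_to S A B n}"
    unfolding bounded_chains_def by (auto simp: finite_nat_set_iff_bounded_le)
  moreover have "0 \<in> {n. chain_to S A B n}" using assms by (auto intro: chain_to.base)
  ultimately have "chain_length S A B \<in> {n. chain_to S A B n}"
    unfolding chain_length_def using Max_in by (metis empty_iff)
  then show ?thesis by simp
qed

lemma chain_length_refl:
  assumes "bounded_chains S" "S A"
  shows "chain_length S A A = 0"
proof -
  have "chain_to S A A (chain_length S A A)" using chain_length_attained assms by blast
  then show ?thesis
  proof cases
    case (step X n)
    then show ?thesis using chain_to_sub[of S A X n] by auto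
  qed simp
qed

section \<open>Series killed by products of binomials\<close>

lemma act_superset:
  assumes "finite F" "Poly_Mapping.keys b \<subseteq> F"
  shows "act b a t = (\<Sum>u\<in>F. Poly_Mapping.lookup b u * a (t - u))"
  unfolding act_def using assms
  by (intro sum.mono_neutral_left) (auto simp: in_keys_iff)

lemma act_add: "act (p + q) a = (\<lambda>t. act p a t + act q a t)"
proof
  fix t
  let ?F = "Poly_Mapping.keys p \<union> Poly_Mapping.keys q"
  have "act (p + q) a t = (\<Sum>u\<in>?F. Poly_Mapping.lookup (p + q) u * a (t - u))"
    by (rule act_superset) (auto simp: Poly_Mapping.keys_add)
  also have "\<dots> = act p a t + act q a t"
    by (simp add: act_superset[of ?F p] act_superset[of ?F q] lookup_add ring_distribs sum.distrib)
  finally show "act (p + q) a t = act p a t + act q a t" .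
qed

lemma act_single: "act (Poly_Mapping.single u c) a t = c * a (t - u)"
  by (subst act_superset[of "{u}"]) (auto simp: lookup_single)

lemma act_add_right: "act p (\<lambda>t. a t + b t) = (\<lambda>t. act p a t + act p b t)"
  by (simp add: act_def ring_distribs sum.distrib)

text \<open>Identities that are additive in a polynomial need to be checked on monomials only:
  updating a polynomial at a new exponent is the addition of a monomial.\<close>

lemma poly_mapping_additive_induct [case_names single add]:
  fixes p :: "'a \<Rightarrow>\<^sub>0 'b::comm_monoid_add"
  assumes "\<And>u c. P (Poly_Mapping.single u c)" "\<And>p q. P p \<Longrightarrow> P q \<Longrightarrow> P (p + q)"
  shows "P p"
proof (induction p rule: update_induct)
  case const
  have "P (Poly_Mapping.single undefined 0)" by (rule assms(1))
  then show ?case by simp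
next
  case (update f a b)
  have "Poly_Mapping.update a b f = f + Poly_Mapping.single a b"
    using update by (intro poly_mapping_eqI)
      (auto simp: lookup_update lookup_add lookup_single in_keys_iff when_def)
  then show ?case using assms update by metis
qed

lemma act_mult: "act (p * q) a = act p (act q a)"
proof (induction p rule: poly_mapping_additive_induct)
  case (single u c)
  show ?case
  proof (induction q rule: poly_mapping_additive_induct)
    case (single v d)
    show ?case by (simp add: mult_single act_single fun_eq_iff algebra_simps)
  next
    case (add p q)
    then show ?case by (simp add: ring_distribs act_add act_add_right)
  qed
next
  case (add p q)
  then show ?case by (simp add: ring_distribs act_add)
qed

lemma act_one: "act 1 a = a"
  by (rule ext) (simp add: act_single flip: single_one)

text \<open>A Laurent polynomial, read as a series, is its own action on the series 1, so the claim
  is an instance of \<open>act_mult\<close>.\<close>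

lemma act_lookup: "act p (Poly_Mapping.lookup q) = Poly_Mapping.lookup (p * q)"
proof -
  have "Poly_Mapping.lookup q = act q (\<lambda>t. if t = 0 then 1 else 0)" for q :: "'a laurent_poly"
  proof (induction q rule: poly_mapping_additive_induct)
    case (single u c)
    then show ?case by (auto simp: fun_eq_iff act_single lookup_single when_def)
  next
    case (add p q)
    then show ?case by (simp add: fun_eq_iff act_add lookup_add)
  qed
  then show ?thesis by (metis act_mult)
qed

lemma is_laurent_poly_act: "is_laurent_poly a \<Longrightarrow> is_laurent_poly (act p a)"
  unfolding is_laurent_poly_def by (auto simp: act_lookup)

lemma is_laurent_poly_add:
  "is_laurent_poly a \<Longrightarrow> is_laurent_poly b \<Longrightarrow> is_laurent_poly (\<lambda>t. a t + b t)"
  unfolding is_laurent_poly_def by (auto simp: fun_eq_iff lookup_add intro: exI[of _ "_ + _"])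

lemma act_binomial: "act (1 - zpow v) a t = a t - a (t - v)"
proof -
  have eq: "1 - zpow v = 1 + Poly_Mapping.single v (- 1)" by (simp add: single_uminus)
  show ?thesis unfolding eq act_add by (simp add: act_one act_single)
qed

section \<open>Summability by products of binomials\<close>

definition binomials :: "(rat ^ 'd) list \<Rightarrow> 'd::finite laurent_poly" where
  "binomials vs = (\<Prod>v\<leftarrow>vs. 1 - zpow v)"

text \<open>The first conclusion of the theorem. Exponents form a list because a factor may be
  needed several times, and they may be rational; integrality is arranged at the very end.\<close>

definition binomial_summable :: "(rat ^ 'd) set \<Rightarrow> 'd::finite laurent_series \<Rightarrow> bool" where
  "binomial_summable G a \<longleftrightarrow>
     (\<exists>vs. set vs \<subseteq> G - {0} \<and> is_laurent_poly (act (binomials vs) a))"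

text \<open>The product of both denominators works for the sum, as each summand stays a Laurent
  polynomial under the other factor.\<close>

lemma binomial_summable_add:
  assumes "binomial_summable G a" "binomial_summable G b"
  shows "binomial_summable G (\<lambda>t. a t + b t)"
proof -
  obtain vs ws where vs: "set vs \<subseteq> G - {0}" "is_laurent_poly (act (binomials vs) a)"
    and ws: "set ws \<subseteq> G - {0}" "is_laurent_poly (act (binomials ws) b)"
    using assms unfolding binomial_summable_def by blast
  have "is_laurent_poly (\<lambda>t. act (binomials ws) (act (binomials vs) a) t +
    act (binomials vs) (act (binomials ws) b) t)"
    by (rule is_laurent_poly_add; rule is_laurent_poly_act; fact)
  also have "(\<lambda>t. act (binomials ws) (act (binomials vs) a) t +
    act (binomials vs) (act (binomials ws) b) t) = act (binomials (vs @ ws)) (\<lambda>t. a t + b t)"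
    by (simp add: binomials_def act_add_right mult.commute flip: act_mult)
  finally show ?thesis unfolding binomial_summable_def using vs ws
    by (intro exI[of _ "vs @ ws"]) auto
qed

text \<open>The difference is \<open>1 - zpow v\<close> acting on \<open>a\<close>, so
  \<open>v\<close> is put in front of the list of exponents.\<close>

lemma binomial_summable_shift_diff:
  assumes "v \<in> G" "v \<noteq> 0" "binomial_summable G (\<lambda>t. a t - a (t - v))"
  shows "binomial_summable G a"
proof -
  obtain vs where vs: "set vs \<subseteq> G - {0}"
    "is_laurent_poly (act (binomials vs) (\<lambda>t. a t - a (t - v)))"
    using assms unfolding binomial_summable_def by blast
  moreover have "(\<lambda>t. a t - a (t - v)) = act (1 - zpow v) a"
    by (simp add: act_binomial fun_eq_iff)
  ultimately have "is_laurent_poly (act (binomials (v # vs)) a)"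
    by (simp add: binomials_def mult.commute flip: act_mult)
  then show ?thesis unfolding binomial_summable_def using assms vs(1)
    by (intro exI[of _ "v # vs"]) auto
qed

lemma binomial_summable_point:
  assumes "\<And>t. t \<noteq> g \<Longrightarrow> a t = 0"
  shows "binomial_summable G a"
proof -
  have "a = Poly_Mapping.lookup (Poly_Mapping.single g (a g))"
    using assms by (auto simp: lookup_single when_def)
  then show ?thesis unfolding binomial_summable_def is_laurent_poly_def
    by (intro exI[of _ "[]"]) (auto simp: binomials_def act_one)
qed

section \<open>From rational to integral exponents\<close>

text \<open>Coefficients of a polynomial killed by \<open>1 - zpow w\<close> are invariant under
  translation by \<open>w\<close>; a nonzero one would then have infinite support. This keeps the
  integral denominator nonzero.\<close>

lemma binomial_mult_nonzero:
  fixes p :: "'d::finite laurent_poly"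
  assumes "w \<noteq> 0" "p \<noteq> 0"
  shows "(1 - zpow w) * p \<noteq> 0"
proof
  assume eq: "(1 - zpow w) * p = 0"
  have "act (1 - zpow w) (Poly_Mapping.lookup p) t = 0" for t
    by (simp add: act_lookup eq)
  then have inv: "Poly_Mapping.lookup p t = Poly_Mapping.lookup p (t - w)" for t
    by (simp add: act_binomial)
  obtain t where t: "Poly_Mapping.lookup p t \<noteq> 0"
    using assms(2) by (auto simp: poly_mapping_eq_iff fun_eq_iff)
  have per: "Poly_Mapping.lookup p (t - of_nat n *s w) = Poly_Mapping.lookup p t" for n
  proof (induction n)
    case (Suc n)
    have "t - of_nat (Suc n) *s w = t - of_nat n *s w - w"
      by (simp add: vec_eq_iff algebra_simps)
    then show ?case using inv[of "t - of_nat n *s w"] Suc by metis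
  qed (simp add: vector_smult_lzero)
  \<comment> \<open>A nonzero coordinate of \<open>w\<close> shows that the translates of
    \<open>t\<close> are pairwise distinct.\<close>
  obtain i where i: "w $ i \<noteq> 0" using assms(1) by (auto simp: vec_eq_iff)
  have "inj (\<lambda>n::nat. t - of_nat n *s w)"
    by (rule injI) (use i in \<open>auto simp: vec_eq_iff\<close>)
  then have "infinite (range (\<lambda>n::nat. t - of_nat n *s w))"
    by (simp add: finite_image_iff)
  moreover have "range (\<lambda>n::nat. t - of_nat n *s w) \<subseteq> Poly_Mapping.keys p"
    using per t by (auto simp: in_keys_iff)
  ultimately show False using finite_subset finite_keys by blast
qed

lemma zpow_power: "zpow v ^ n = zpow (of_nat n *s v)"
proof (induction n)
  case 0
  have "of_nat 0 *s v = 0" by (simp add: vec_eq_iff)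
  then show ?case by simp
next
  case (Suc n)
  have "v + of_nat n *s v = of_nat (Suc n) *s v" by (simp add: vec_eq_iff algebra_simps)
  then show ?case using Suc by (simp add: mult_single)
qed

text \<open>Take \<open>w\<close> to be \<open>v\<close> times the product \<open>n\<close> of the
  denominators of its coordinates; the geometric sum shows that \<open>1 - x\<close> divides
  \<open>1 - x ^ n\<close>.\<close>

lemma binomial_dvd_integral:
  fixes v :: "rat ^ 'd::finite"
  assumes "v \<noteq> 0"
  obtains w :: "rat ^ 'd" where "w \<noteq> 0" "\<forall>i. w $ i \<in> \<int>" "(1 - zpow v) dvd (1 - zpow w)"
proof -
  define n where "n = (\<Prod>i\<in>UNIV. nat (snd (quotient_of (v $ i))))"
  have pos: "snd (quotient_of (v $ i)) > 0" for i
    using quotient_of_denom_pos' by blast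
  have "n > 0" unfolding n_def using pos by (auto intro!: prod_pos)
  have int: "of_nat n * v $ i \<in> \<int>" for i
  proof -
    let ?b = "snd (quotient_of (v $ i))"
    have "nat ?b dvd n" unfolding n_def by (rule dvd_prodI) auto
    then obtain k where "n = nat ?b * k" by blast
    moreover have "v $ i = of_int (fst (quotient_of (v $ i))) / of_int ?b"
      using quotient_of_div by (metis prod.collapse)
    moreover have "of_nat (nat ?b) = (of_int ?b :: rat)" using pos[of i] by simp
    ultimately have "of_nat n * v $ i = of_nat k * of_int (fst (quotient_of (v $ i)))"
      using pos[of i] by (simp add: field_simps)
    then show ?thesis by simp
  qed
  have "(1 - zpow v) dvd (1 - zpow v ^ n)"
    by (metis dvd_triv_left one_diff_power_eq)
  then show ?thesis
    using that[of "of_nat n *s v"] assms \<open>n > 0\<close> int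
    by (simp add: zpow_power vec_eq_iff)
qed

lemma integral_exponents_mult:
  assumes "integral_exponents p" "integral_exponents q"
  shows "integral_exponents (p * q)"
  unfolding integral_exponents_def
proof safe
  fix u i
  assume "u \<in> Poly_Mapping.keys (p * q)"
  then obtain a b where "u = a + b" "a \<in> Poly_Mapping.keys p" "b \<in> Poly_Mapping.keys q"
    using keys_mult[of p q] by blast
  then show "u $ i \<in> \<int>" using assms by (simp add: integral_exponents_def)
qed

lemma integral_exponents_binomial:
  assumes "\<forall>i. w $ i \<in> \<int>"
  shows "integral_exponents (1 - zpow w)"
proof -
  have "Poly_Mapping.keys (1 - zpow w) \<subseteq> {0, w}"
    by (auto simp: in_keys_iff lookup_minus lookup_single when_def lookup_one split: if_splits)
  then show ?thesis using assms unfolding integral_exponents_def by fastforce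
qed

text \<open>Each factor is replaced by an integral multiple of it, one at a time.\<close>

lemma binomials_dvd_integral:
  assumes "0 \<notin> set vs"
  shows "\<exists>b. b \<noteq> 0 \<and> integral_exponents b \<and> binomials vs dvd b"
  using assms
proof (induction vs)
  case Nil
  show ?case by (intro exI[of _ 1]) (auto simp: binomials_def integral_exponents_def)
next
  case (Cons v vs)
  then obtain b where b: "b \<noteq> 0" "integral_exponents b" "binomials vs dvd b" by auto
  obtain w where w: "w \<noteq> 0" "\<forall>i. w $ i \<in> \<int>" "(1 - zpow v) dvd (1 - zpow w)"
    using Cons.prems binomial_dvd_integral[of v] by auto
  show ?case
    using b w binomial_mult_nonzero[of w b] integral_exponents_mult[of "1 - zpow w" b]
      integral_exponents_binomial[of w] mult_dvd_mono[of "1 - zpow v" "1 - zpow w" "binomials vs" b]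
    by (intro exI[of _ "(1 - zpow w) * b"]) (auto simp: binomials_def)
qed

lemma binomial_summable_imp_summable:
  assumes "binomial_summable G a"
  shows "summable_series a"
proof -
  obtain vs where vs: "set vs \<subseteq> G - {0}" "is_laurent_poly (act (binomials vs) a)"
    using assms unfolding binomial_summable_def by blast
  then obtain b where b: "b \<noteq> 0" "integral_exponents b" "binomials vs dvd b"
    using binomials_dvd_integral by blast
  then obtain c where "b = c * binomials vs" by (auto simp: mult.commute)
  then have "is_laurent_poly (act b a)" using vs(2) by (simp add: act_mult is_laurent_poly_act)
  then show ?thesis using b unfolding summable_series_def by blast
qed

section \<open>Homogeneous components\<close>

text \<open>For \<open>x\<close> in the carrier of a direct sum, the defining property of
  \<open>internal_direct_sum\<close> makes this description unique.\<close>

definition component :: "('a, 'm) ring_scheme \<Rightarrow> 'i set \<Rightarrow> ('i \<Rightarrow> 'a set) \<Rightarrow> 'a \<Rightarrow> 'i \<Rightarrow> 'a" where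
  "component A I C x = (THE f.
     (\<forall>g\<in>I. f g \<in> C g) \<and> (\<forall>g. g \<notin> I \<longrightarrow> f g = \<zero>\<^bsub>A\<^esub>) \<and>
     finite {g. f g \<noteq> \<zero>\<^bsub>A\<^esub>} \<and> x = finsum A f {g. f g \<noteq> \<zero>\<^bsub>A\<^esub>})"

lemma component_props:
  assumes "internal_direct_sum A I C" "x \<in> carrier A"
  shows "\<And>g. g \<in> I \<Longrightarrow> component A I C x g \<in> C g"
    and "\<And>g. g \<notin> I \<Longrightarrow> component A I C x g = \<zero>\<^bsub>A\<^esub>"
    and "finite {g. component A I C x g \<noteq> \<zero>\<^bsub>A\<^esub>}"
    and "finsum A (component A I C x) {g. component A I C x g \<noteq> \<zero>\<^bsub>A\<^esub>} = x"
  using assms(1)[unfolded internal_direct_sum_def, THEN conjunct2, rule_format, OF assms(2), THEN theI']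
  unfolding component_def[symmetric] by (blast, blast, blast, metis)

lemma direct_sum_subgroup:
  "internal_direct_sum A I C \<Longrightarrow> g \<in> I \<Longrightarrow> additive_subgroup (C g) A"
  unfolding internal_direct_sum_def by blast

lemma direct_sum_carrier:
  "internal_direct_sum A I C \<Longrightarrow> g \<in> I \<Longrightarrow> x \<in> C g \<Longrightarrow> x \<in> carrier A"
  by (rule additive_subgroup.a_Hcarr[OF direct_sum_subgroup])

context abelian_group
begin

text \<open>The working form of uniqueness: any finite sum of homogeneous terms, possibly with zero
  terms among them, gives the decomposition after extension by zero.\<close>

lemma component_unique:
  assumes ds: "internal_direct_sum G I C" and F: "finite F" "F \<subseteq> I"
    and f: "\<And>g. g \<in> F \<Longrightarrow> f g \<in> C g" and x: "x = finsum G f F"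
  shows "component G I C x = (\<lambda>g. if g \<in> F then f g else \<zero>)"
proof -
  let ?f = "\<lambda>g. if g \<in> F then f g else \<zero>"
  have fc: "f \<in> F \<rightarrow> carrier G"
    using f F(2) by (intro Pi_I direct_sum_carrier[OF ds]) auto
  have xc: "x \<in> carrier G" unfolding x using fc by (rule finsum_closed)
  have "x = finsum G ?f {g. ?f g \<noteq> \<zero>}"
    unfolding x using F fc by (intro add.finprod_mono_neutral_cong_right) (auto split: if_splits)
  moreover have "\<forall>g\<in>I. ?f g \<in> C g"
    by (simp add: f additive_subgroup.zero_closed[OF direct_sum_subgroup[OF ds]])
  moreover have "finite {g. ?f g \<noteq> \<zero>}" using F(1) by (rule rev_finite_subset) auto
  moreover have "\<exists>!f. (\<forall>g\<in>I. f g \<in> C g) \<and> (\<forall>g. g \<notin> I \<longrightarrow> f g = \<zero>) \<and>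
        finite {g. f g \<noteq> \<zero>} \<and> x = finsum G f {g. f g \<noteq> \<zero>}"
    using ds xc unfolding internal_direct_sum_def by blast
  ultimately show ?thesis
    unfolding component_def using F(2) by (intro the1_equality) (assumption, auto)
qed

lemma component_homogeneous:
  assumes "internal_direct_sum G I C" "t \<in> I" "x \<in> C t"
  shows "component G I C x = (\<lambda>g. if g = t then x else \<zero>)"
proof -
  have "x \<in> carrier G"
    by (rule direct_sum_carrier[OF assms])
  then show ?thesis
    using component_unique[OF assms(1), of "{t}" "\<lambda>_. x" x] assms by auto
qed

lemma component_zero:
  assumes "internal_direct_sum G I C"
  shows "component G I C \<zero> = (\<lambda>g. \<zero>)"
  using component_unique[OF assms, of "{}" "\<lambda>_. \<zero>" \<zero>] by auto

lemma component_carrier: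
  assumes "internal_direct_sum G I C" "x \<in> carrier G"
  shows "component G I C x g \<in> carrier G"
  by (cases "g \<in> I")
    (auto simp: component_props(2)[OF assms] intro: direct_sum_carrier[OF assms(1) _ component_props(1)[OF assms]])

lemma component_add:
  assumes ds: "internal_direct_sum G I C" and xy: "x \<in> carrier G" "y \<in> carrier G"
  shows "component G I C (x \<oplus> y) = (\<lambda>g. component G I C x g \<oplus> component G I C y g)"
proof -
  let ?cx = "component G I C x" and ?cy = "component G I C y"
  \<comment> \<open>A common finite index set, so that both decompositions can be added
    termwise.\<close>
  let ?F = "{g. ?cx g \<noteq> \<zero>} \<union> {g. ?cy g \<noteq> \<zero>}"
  have fin: "finite ?F" using component_props(3)[OF ds] xy by auto
  have sub: "?F \<subseteq> I" using component_props(2)[OF ds] xy by auto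
  have cc: "?cx g \<in> carrier G" "?cy g \<in> carrier G" for g
    using component_carrier[OF ds] xy by auto
  have x: "x = finsum G ?cx ?F"
    by (subst component_props(4)[OF ds xy(1), symmetric], rule add.finprod_mono_neutral_cong_left)
      (use fin cc in auto)
  have y: "y = finsum G ?cy ?F"
    by (subst component_props(4)[OF ds xy(2), symmetric], rule add.finprod_mono_neutral_cong_left)
      (use fin cc in auto)
  have "x \<oplus> y = finsum G ?cx ?F \<oplus> finsum G ?cy ?F" using x y by simp
  also have "\<dots> = finsum G (\<lambda>g. ?cx g \<oplus> ?cy g) ?F"
    using cc by (intro add.finprod_multf[symmetric]) auto
  finally have "component G I C (x \<oplus> y) = (\<lambda>g. if g \<in> ?F then ?cx g \<oplus> ?cy g else \<zero>)"
    by (rule component_unique[OF ds fin sub, rotated])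
      (rule additive_subgroup.a_closed[OF direct_sum_subgroup[OF ds]];
        use sub component_props(1)[OF ds] xy in blast)
  also have "\<dots> = (\<lambda>g. ?cx g \<oplus> ?cy g)" by auto
  finally show ?thesis .
qed

section \<open>Additive subgroups and their sums\<close>

lemma additive_subgroupI':
  assumes "H \<subseteq> carrier G" "\<zero> \<in> H" "\<And>x y. x \<in> H \<Longrightarrow> y \<in> H \<Longrightarrow> x \<oplus> y \<in> H"
    and "\<And>x. x \<in> H \<Longrightarrow> \<ominus> x \<in> H"
  shows "additive_subgroup H G"
  using assms by (intro additive_subgroup.intro add.subgroupI) auto

lemma additive_subgroup_Int:
  assumes "additive_subgroup H G" "additive_subgroup K G"
  shows "additive_subgroup (H \<inter> K) G"
proof -
  interpret H: additive_subgroup H G by fact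
  interpret K: additive_subgroup K G by fact
  show ?thesis
    by (rule additive_subgroupI') auto
qed

lemma set_add_iff: "z \<in> H <+>\<^bsub>G\<^esub> K \<longleftrightarrow> (\<exists>x\<in>H. \<exists>y\<in>K. z = x \<oplus> y)"
  by (auto simp: set_add_def')

lemma set_add_upper:
  assumes "additive_subgroup H G" "additive_subgroup K G"
  shows "H \<subseteq> H <+>\<^bsub>G\<^esub> K" "K \<subseteq> H <+>\<^bsub>G\<^esub> K"
proof -
  interpret H: additive_subgroup H G by fact
  interpret K: additive_subgroup K G by fact
  have "x = x \<oplus> \<zero>" if "x \<in> H" for x using that by simp
  then show "H \<subseteq> H <+>\<^bsub>G\<^esub> K" unfolding set_add_def' using K.zero_closed by blast
  have "x = \<zero> \<oplus> x" if "x \<in> K" for x using that by simp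
  then show "K \<subseteq> H <+>\<^bsub>G\<^esub> K" unfolding set_add_def' using H.zero_closed by blast
qed

lemma set_add_least:
  assumes "additive_subgroup L G" "H \<subseteq> L" "K \<subseteq> L"
  shows "H <+>\<^bsub>G\<^esub> K \<subseteq> L"
  using assms additive_subgroup.a_closed[OF assms(1)] by (auto simp: set_add_def')

end

section \<open>Graded rings and modules\<close>

text \<open>The module is a parameter so that the locale can also be interpreted with
  \<open>R\<close> as a module over itself. Results on graded submodules then yield results on
  homogeneous ideals.\<close>

locale graded_pair = module R M
  for R :: "('r, 'x) ring_scheme" (structure) and M :: "('r, 'm, 'y) module_scheme" (structure) +
  fixes G :: "'g::ab_group_add set" and Rg :: "'g \<Rightarrow> 'r set" and Mg :: "'g \<Rightarrow> 'm set"
  assumes zero_G: "0 \<in> G" and add_G: "\<And>g h. g \<in> G \<Longrightarrow> h \<in> G \<Longrightarrow> g + h \<in> G"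
    and uminus_G: "\<And>g. g \<in> G \<Longrightarrow> - g \<in> G"
    and graded_R: "graded_ring G R Rg" and graded_M: "graded_module G R Rg M Mg"
begin

lemma diff_G: "g \<in> G \<Longrightarrow> h \<in> G \<Longrightarrow> g - h \<in> G"
  using add_G[of g "- h"] uminus_G by simp

lemma ds_R: "internal_direct_sum R G Rg" and ds_M: "internal_direct_sum M G Mg"
  using graded_R graded_M unfolding graded_ring_def graded_module_def by auto

lemma subgroup_Rg: "g \<in> G \<Longrightarrow> additive_subgroup (Rg g) R"
  and subgroup_Mg: "g \<in> G \<Longrightarrow> additive_subgroup (Mg g) M"
  using direct_sum_subgroup[OF ds_R] direct_sum_subgroup[OF ds_M] by auto

lemma Rg_carrier: "g \<in> G \<Longrightarrow> r \<in> Rg g \<Longrightarrow> r \<in> carrier R"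
  and Mg_carrier: "g \<in> G \<Longrightarrow> x \<in> Mg g \<Longrightarrow> x \<in> carrier M"
  using direct_sum_carrier[OF ds_R] direct_sum_carrier[OF ds_M] by blast+

lemma Rg_mult: "g \<in> G \<Longrightarrow> h \<in> G \<Longrightarrow> r \<in> Rg g \<Longrightarrow> s \<in> Rg h \<Longrightarrow> r \<otimes> s \<in> Rg (g + h)"
  using graded_R unfolding graded_ring_def by blast

lemma Mg_smult: "g \<in> G \<Longrightarrow> h \<in> G \<Longrightarrow> r \<in> Rg g \<Longrightarrow> x \<in> Mg h \<Longrightarrow> r \<odot>\<^bsub>M\<^esub> x \<in> Mg (g + h)"
  using graded_M unfolding graded_module_def by blast

abbreviation cM where "cM \<equiv> component M G Mg"

text \<open>A scalar of degree \<open>h\<close> shifts the whole decomposition by \<open>h\<close>;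
  multiplying termwise and reindexing gives a decomposition of the product, which is unique.\<close>

lemma component_smult:
  assumes h: "h \<in> G" and r: "r \<in> Rg h" and x: "x \<in> carrier M" and t: "t \<in> G"
  shows "cM (r \<odot>\<^bsub>M\<^esub> x) t = r \<odot>\<^bsub>M\<^esub> cM x (t - h)"
proof -
  let ?S = "{g. cM x g \<noteq> \<zero>\<^bsub>M\<^esub>}"
  let ?F = "(\<lambda>g. g + h) ` ?S"
  have rc: "r \<in> carrier R" using Rg_carrier h r .
  have fin: "finite ?S" using component_props(3)[OF ds_M x] .
  have cc: "cM x g \<in> carrier M" for g using M.component_carrier[OF ds_M x] .
  have SG: "?S \<subseteq> G" using component_props(2)[OF ds_M x] by auto
  have "r \<odot>\<^bsub>M\<^esub> x = r \<odot>\<^bsub>M\<^esub> finsum M (cM x) ?S" using component_props(4)[OF ds_M x] by simp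
  also have "\<dots> = (\<Oplus>\<^bsub>M\<^esub>g\<in>?S. r \<odot>\<^bsub>M\<^esub> cM x g)"
    using fin rc cc by (intro finsum_smult_ldistr) auto
  also have "\<dots> = (\<Oplus>\<^bsub>M\<^esub>g\<in>?S. r \<odot>\<^bsub>M\<^esub> cM x ((g + h) - h))" by simp
  also have "\<dots> = (\<Oplus>\<^bsub>M\<^esub>g\<in>?F. r \<odot>\<^bsub>M\<^esub> cM x (g - h))"
    using rc cc by (intro M.add.finprod_reindex[symmetric]) (auto simp: inj_on_def)
  finally have "cM (r \<odot>\<^bsub>M\<^esub> x) = (\<lambda>g. if g \<in> ?F then r \<odot>\<^bsub>M\<^esub> cM x (g - h) else \<zero>\<^bsub>M\<^esub>)"
  proof (intro M.component_unique[OF ds_M])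
    show "r \<odot>\<^bsub>M\<^esub> cM x (g - h) \<in> Mg g" if "g \<in> ?F" for g
    proof -
      from that obtain g' where g': "g = g' + h" "g' \<in> G" using SG by auto
      then show ?thesis
        using Mg_smult[OF h _ r component_props(1)[OF ds_M x], of g'] by (simp add: add.commute)
    qed
  qed (use fin SG h add_G in auto)
  moreover have "r \<odot>\<^bsub>M\<^esub> cM x (t - h) = \<zero>\<^bsub>M\<^esub>" if "t \<notin> ?F"
  proof -
    have "cM x (t - h) = \<zero>\<^bsub>M\<^esub>"
    proof (rule ccontr)
      assume "cM x (t - h) \<noteq> \<zero>\<^bsub>M\<^esub>"
      then have "(t - h) + h \<in> ?F" by blast
      then show False using that by simp
    qed
    then show ?thesis using rc by simp
  qed
  ultimately show ?thesis by simp
qed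

end

section \<open>The ring as a graded module over itself\<close>

definition regular_module :: "('r, 'x) ring_scheme \<Rightarrow> ('r, 'r) module" where
  "regular_module R = \<lparr>carrier = carrier R, monoid.mult = (\<otimes>\<^bsub>R\<^esub>), one = \<one>\<^bsub>R\<^esub>,
     zero = \<zero>\<^bsub>R\<^esub>, add = (\<oplus>\<^bsub>R\<^esub>), smult = (\<otimes>\<^bsub>R\<^esub>)\<rparr>"

lemma regular_module_simps [simp]:
  "carrier (regular_module R) = carrier R" "zero (regular_module R) = zero R"
  "add (regular_module R) = add R" "smult (regular_module R) = mult R"
  by (simp_all add: regular_module_def)

lemma finsum_regular_module [simp]: "finsum (regular_module R) = finsum R"
  by (simp add: finsum_def finprod_def fun_eq_iff)

lemma additive_subgroup_regular_module [simp]: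
  "additive_subgroup H (regular_module R) = additive_subgroup H R"
  by (simp add: additive_subgroup_def subgroup_def m_inv_def)

lemma component_regular_module [simp]:
  "component (regular_module R) = component R"
  by (simp add: component_def fun_eq_iff)

lemma (in cring) module_regular_module: "module R (regular_module R)"
proof (rule moduleI)
  show "abelian_group (regular_module R)"
    by (rule abelian_groupI) (auto simp: a_ac intro!: bexI[of _ "\<ominus> _"] l_neg)
qed (auto simp: cring_axioms l_distr r_distr m_assoc)

lemma (in graded_pair) graded_pair_regular: "graded_pair R (regular_module R) G Rg Rg"
proof -
  have "graded_module G R Rg (regular_module R) Rg"
    unfolding graded_module_def internal_direct_sum_def
    using module_regular_module ds_R Rg_mult
    by (simp add: internal_direct_sum_def)
  then show ?thesis
    using module_regular_module zero_G add_G uminus_G graded_R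
    by (simp add: graded_pair_def graded_pair_axioms_def)
qed

context graded_pair
begin

text \<open>Let \<open>?e\<close> be the degree 0 part of 1. Comparing parts of degree
  \<open>h\<close> in \<open>s = s \<otimes> \<one>\<close> gives \<open>s \<otimes> ?e = s\<close>
  for every homogeneous \<open>s\<close>. Applied to all parts of 1 and summed, this yields
  \<open>?e = \<one>\<close>.\<close>

lemma one_homogeneous: "\<one> \<in> Rg 0"
proof -
  interpret reg: graded_pair R "regular_module R" G Rg Rg by (rule graded_pair_regular)
  let ?c = "component R G Rg \<one>"
  let ?S = "{g. ?c g \<noteq> \<zero>}"
  let ?e = "?c 0"
  have e0: "?e \<in> Rg 0" using component_props(1)[OF ds_R, of \<one>] zero_G by simp
  then have ec: "?e \<in> carrier R" using Rg_carrier zero_G by blast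
  have e: "s \<otimes> ?e = s" if "h \<in> G" "s \<in> Rg h" for h s
  proof -
    have sc: "s \<in> carrier R" using that Rg_carrier by blast
    have "component R G Rg (s \<otimes> \<one>) h = s \<otimes> ?e"
      using reg.component_smult[of h s \<one> h] that by simp
    moreover have "component R G Rg s h = s" using R.component_homogeneous[OF ds_R that] by simp
    ultimately show ?thesis using sc by simp
  qed
  have fin: "finite ?S" and SG: "?S \<subseteq> G" and cc: "\<And>g. ?c g \<in> carrier R"
    using component_props(2,3)[OF ds_R, of \<one>] R.component_carrier[OF ds_R, of \<one>] by auto
  have "?e = finsum R ?c ?S \<otimes> ?e"
    using ec component_props(4)[OF ds_R, of \<one>] by simp
  also have "\<dots> = (\<Oplus>g\<in>?S. ?c g \<otimes> ?e)"
    using fin cc ec by (intro finsum_ldistr) auto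
  also have "\<dots> = finsum R ?c ?S"
    using SG cc e component_props(1)[OF ds_R, of \<one>] ec
    by (intro R.add.finprod_cong') auto
  also have "\<dots> = \<one>" using component_props(4)[OF ds_R, of \<one>] by simp
  finally show ?thesis using e0 by simp
qed

section \<open>Graded submodules given by their components\<close>

text \<open>A graded submodule is handled through its components \<open>N t\<close>;
  \<open>total\<close> recovers the submodule itself. The values of \<open>N\<close> outside
  \<open>G\<close> are left unconstrained.\<close>

definition homogeneous_family :: "('g \<Rightarrow> 'm set) \<Rightarrow> bool" where
  "homogeneous_family N \<longleftrightarrow>
     (\<forall>t\<in>G. additive_subgroup (N t) M \<and> N t \<subseteq> Mg t) \<and>
     (\<forall>h\<in>G. \<forall>t\<in>G. \<forall>r\<in>Rg h. \<forall>x\<in>N t. r \<odot>\<^bsub>M\<^esub> x \<in> N (h + t))"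

definition total :: "('g \<Rightarrow> 'm set) \<Rightarrow> 'm set" where
  "total N = {x \<in> carrier M. \<forall>t\<in>G. cM x t \<in> N t}"

lemma homogeneous_familyD:
  assumes "homogeneous_family N" "t \<in> G"
  shows "additive_subgroup (N t) M" "N t \<subseteq> Mg t" "\<zero>\<^bsub>M\<^esub> \<in> N t"
    and "\<And>x y. x \<in> N t \<Longrightarrow> y \<in> N t \<Longrightarrow> x \<oplus>\<^bsub>M\<^esub> y \<in> N t"
    and "\<And>h r x. h \<in> G \<Longrightarrow> r \<in> Rg h \<Longrightarrow> x \<in> N t \<Longrightarrow> r \<odot>\<^bsub>M\<^esub> x \<in> N (h + t)"
proof -
  show *: "additive_subgroup (N t) M" and "N t \<subseteq> Mg t"
    and "\<And>h r x. h \<in> G \<Longrightarrow> r \<in> Rg h \<Longrightarrow> x \<in> N t \<Longrightarrow> r \<odot>\<^bsub>M\<^esub> x \<in> N (h + t)"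
    using assms unfolding homogeneous_family_def by auto
  show "\<zero>\<^bsub>M\<^esub> \<in> N t" by (rule additive_subgroup.zero_closed[OF *])
  show "\<And>x y. x \<in> N t \<Longrightarrow> y \<in> N t \<Longrightarrow> x \<oplus>\<^bsub>M\<^esub> y \<in> N t"
    by (rule additive_subgroup.a_closed[OF *])
qed

text \<open>The element has its single possibly nonzero component in degree \<open>t\<close>.
  Passing from \<open>N\<close> to \<open>total N\<close> therefore loses nothing in degrees of
  \<open>G\<close>.\<close>

lemma total_homogeneous:
  assumes "homogeneous_family N" "t \<in> G" "x \<in> Mg t"
  shows "x \<in> total N \<longleftrightarrow> x \<in> N t"
proof -
  have "x \<in> total N \<longleftrightarrow> (\<forall>g\<in>G. (if g = t then x else \<zero>\<^bsub>M\<^esub>) \<in> N g)"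
    using Mg_carrier[OF assms(2,3)]
    by (simp add: total_def M.component_homogeneous[OF ds_M assms(2,3)])
  then show ?thesis
    using assms(2) homogeneous_familyD(3)[OF assms(1)] by auto
qed

lemma total_zero: "homogeneous_family N \<Longrightarrow> \<zero>\<^bsub>M\<^esub> \<in> total N"
  unfolding total_def by (simp add: M.component_zero[OF ds_M] homogeneous_familyD(3))

lemma total_add:
  assumes "homogeneous_family N" "x \<in> total N" "y \<in> total N"
  shows "x \<oplus>\<^bsub>M\<^esub> y \<in> total N"
  using assms(2,3) homogeneous_familyD(4)[OF assms(1)]
  unfolding total_def by (simp add: M.component_add[OF ds_M])

text \<open>For a homogeneous scalar this is \<open>component_smult\<close>; an arbitrary one is the
  finite sum of its homogeneous parts.\<close>

lemma total_smult:
  assumes N: "homogeneous_family N" and x: "x \<in> total N" and r: "r \<in> carrier R"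
  shows "r \<odot>\<^bsub>M\<^esub> x \<in> total N"
proof -
  let ?c = "component R G Rg r"
  let ?S = "{g. ?c g \<noteq> \<zero>}"
  have xc: "x \<in> carrier M" using x by (simp add: total_def)
  have hom: "s \<odot>\<^bsub>M\<^esub> x \<in> total N" if s: "h \<in> G" "s \<in> Rg h" for s h
  proof -
    have "cM (s \<odot>\<^bsub>M\<^esub> x) t \<in> N t" if t: "t \<in> G" for t
    proof -
      have "s \<odot>\<^bsub>M\<^esub> cM x (t - h) \<in> N (h + (t - h))"
        using N s t x diff_G[OF t s(1)] unfolding homogeneous_family_def total_def by blast
      then show ?thesis using component_smult[OF s xc t] by simp
    qed
    then show ?thesis using xc Rg_carrier[OF s] by (simp add: total_def)
  qed
  have cc: "?c g \<in> carrier R" for g using R.component_carrier[OF ds_R r] .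
  have "finsum R ?c F \<odot>\<^bsub>M\<^esub> x \<in> total N" if "finite F" "F \<subseteq> ?S" for F
    using that
  proof (induction F rule: finite_induct)
    case empty
    then show ?case using total_zero[OF N] xc by simp
  next
    case (insert g F)
    have "g \<in> G" using insert.prems component_props(2)[OF ds_R r] by auto
    then have "?c g \<odot>\<^bsub>M\<^esub> x \<in> total N" using hom component_props(1)[OF ds_R r] by blast
    moreover have "finsum R ?c (insert g F) = ?c g \<oplus> finsum R ?c F"
      using insert cc by (intro R.finsum_insert) auto
    moreover have "finsum R ?c F \<in> carrier R" using cc by (intro R.finsum_closed) auto
    ultimately show ?case using insert xc cc total_add[OF N] by (simp add: smult_l_distr)
  qed
  from this[of ?S] show ?thesis
    using component_props(3)[OF ds_R r] by (simp add: component_props(4)[OF ds_R r])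
qed

lemma total_finsum:
  assumes N: "homogeneous_family N" and "finite S" and "\<And>s. s \<in> S \<Longrightarrow> f s \<in> total N"
  shows "finsum M f S \<in> total N"
  using assms(2,3)
proof (induction S rule: finite_induct)
  case empty
  then show ?case using total_zero[OF N] by simp
next
  case (insert s S)
  have "f \<in> S \<rightarrow> carrier M" "f s \<in> carrier M" using insert.prems by (auto simp: total_def)
  then show ?case using insert total_add[OF N] by simp
qed

lemma total_additive_subgroup:
  assumes N: "homogeneous_family N"
  shows "additive_subgroup (total N) M"
proof (rule M.additive_subgroupI')
  show "\<ominus>\<^bsub>M\<^esub> x \<in> total N" if "x \<in> total N" for x
  proof -
    have "(\<ominus> \<one>) \<odot>\<^bsub>M\<^esub> x = \<ominus>\<^bsub>M\<^esub> x"
      using that by (simp add: smult_l_minus total_def)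
    then show ?thesis using total_smult[OF N that, of "\<ominus> \<one>"] by simp
  qed
  show "total N \<subseteq> carrier M" by (auto simp: total_def)
qed (auto simp: total_zero[OF N] total_add[OF N])

end

context graded_pair
begin

section \<open>Lengths of homogeneous pieces\<close>

text \<open>The submodules of \<open>Mg t\<close> over the degree 0 part of the ring, phrased inside
  \<open>M\<close> and \<open>R\<close> instead of the restricted records;
  \<open>homogeneous_submodule_iff\<close> proves the agreement.\<close>

definition homogeneous_submodule :: "'g \<Rightarrow> 'm set \<Rightarrow> bool" where
  "homogeneous_submodule t X \<longleftrightarrow>
     additive_subgroup X M \<and> X \<subseteq> Mg t \<and> (\<forall>r\<in>Rg 0. \<forall>x\<in>X. r \<odot>\<^bsub>M\<^esub> x \<in> X)"

lemma homogeneous_family_submodule: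
  assumes "homogeneous_family N" "t \<in> G"
  shows "homogeneous_submodule t (N t)"
  using homogeneous_familyD[OF assms] zero_G unfolding homogeneous_submodule_def
  by (metis add_0)

lemma homogeneous_submodule_iff:
  assumes "t \<in> G"
  shows "submodule X (R\<lparr>carrier := Rg 0\<rparr>) (M\<lparr>carrier := Mg t\<rparr>) \<longleftrightarrow> homogeneous_submodule t X"
proof -
  have sub: "subgroup (Mg t) (add_monoid M)"
    using subgroup_Mg[OF assms] by (simp add: additive_subgroup_def)
  have eq: "add_monoid (M\<lparr>carrier := Mg t\<rparr>) = (add_monoid M)\<lparr>carrier := Mg t\<rparr>" by simp
  have "subgroup X (add_monoid (M\<lparr>carrier := Mg t\<rparr>)) \<longleftrightarrow> additive_subgroup X M \<and> X \<subseteq> Mg t"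
    unfolding eq additive_subgroup_def
    using group.incl_subgroup[OF M.a_group sub] group.subgroup_incl[OF M.a_group _ sub]
      subgroup.subset[of X "(add_monoid M)\<lparr>carrier := Mg t\<rparr>"] by auto
  then show ?thesis
    unfolding submodule_def submodule_axioms_def homogeneous_submodule_def by auto
qed

lemma homogeneous_submodule_zero:
  "t \<in> G \<Longrightarrow> homogeneous_submodule t X \<Longrightarrow> {\<zero>\<^bsub>M\<^esub>} \<subseteq> X"
  using additive_subgroup.zero_closed unfolding homogeneous_submodule_def by blast

lemma component_length_eq_Sup:
  assumes "t \<in> G"
  shows "component_length R Rg M Mg t =
    Sup (enat ` {n. \<exists>X. chain_to (homogeneous_submodule t) {\<zero>\<^bsub>M\<^esub>} X n})"
proof -
  have "(\<exists>X. chain_to (homogeneous_submodule t) {\<zero>\<^bsub>M\<^esub>} X n) \<longleftrightarrow>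
    (\<exists>N. (\<forall>i\<le>n. homogeneous_submodule t (N i)) \<and> (\<forall>i<n. N i \<subset> N (Suc i)))" for n
    by (rule chain_to_iff_sequence[OF homogeneous_submodule_zero[OF assms]])
  then show ?thesis
    unfolding component_length_def module_length_def homogeneous_submodule_iff[OF assms]
      setcompr_eq_image by simp
qed

lemma bounded_chains_homogeneous:
  assumes "t \<in> G" "component_length R Rg M Mg t \<noteq> \<infinity>"
  shows "bounded_chains (homogeneous_submodule t)"
proof -
  obtain K where K: "component_length R Rg M Mg t = enat K" using assms(2) by auto
  have "n \<le> K" if "chain_to (homogeneous_submodule t) A X n" for A X n
  proof -
    \<comment> \<open>Zero lies in every submodule, so the identity map lowers the bottom condition
      from \<open>A\<close> to zero.\<close>
    have "chain_to (homogeneous_submodule t) {\<zero>\<^bsub>M\<^esub>} X n"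
      using chain_to_map[OF that order.refl, where S' = "homogeneous_submodule t"
          and A' = "{\<zero>\<^bsub>M\<^esub>}" and \<phi> = "\<lambda>X. X"]
        homogeneous_submodule_zero[OF assms(1)] by auto
    then have "enat n \<le> component_length R Rg M Mg t"
      unfolding component_length_eq_Sup[OF assms(1)] by (intro Sup_upper) auto
    then show ?thesis using K by simp
  qed
  then show ?thesis unfolding bounded_chains_def by blast
qed

lemma homogeneous_submodule_Mg: "t \<in> G \<Longrightarrow> homogeneous_submodule t (Mg t)"
  using subgroup_Mg Mg_smult zero_G unfolding homogeneous_submodule_def by fastforce

text \<open>The supremum ranges over chains with any top, but each can be made to end at
  \<open>Mg t\<close> without changing its number of steps.\<close>

lemma component_length_eq_chain_length:
  assumes "t \<in> G" "component_length R Rg M Mg t \<noteq> \<infinity>"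
  shows "component_length R Rg M Mg t =
    enat (chain_length (homogeneous_submodule t) {\<zero>\<^bsub>M\<^esub>} (Mg t))"
proof -
  note bd = bounded_chains_homogeneous[OF assms]
  note top = homogeneous_submodule_Mg[OF assms(1)]
  note att = chain_length_attained[OF bd top homogeneous_submodule_zero[OF assms(1) top]]
  show ?thesis
    unfolding component_length_eq_Sup[OF assms(1)]
  proof (rule antisym)
    show "Sup (enat ` {n. \<exists>X. chain_to (homogeneous_submodule t) {\<zero>\<^bsub>M\<^esub>} X n})
      \<le> enat (chain_length (homogeneous_submodule t) {\<zero>\<^bsub>M\<^esub>} (Mg t))"
    proof (rule Sup_least)
      fix e assume "e \<in> enat ` {n. \<exists>X. chain_to (homogeneous_submodule t) {\<zero>\<^bsub>M\<^esub>} X n}"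
      then obtain n X where e: "e = enat n"
        and ch: "chain_to (homogeneous_submodule t) {\<zero>\<^bsub>M\<^esub>} X n" by auto
      have "X \<subseteq> Mg t" using chain_to_sub[OF ch] by (simp add: homogeneous_submodule_def)
      then show "e \<le> enat (chain_length (homogeneous_submodule t) {\<zero>\<^bsub>M\<^esub>} (Mg t))"
        using chain_length_ge[OF bd chain_to_mono_top[OF ch _ top]] e by simp
    qed
    show "enat (chain_length (homogeneous_submodule t) {\<zero>\<^bsub>M\<^esub>} (Mg t))
      \<le> Sup (enat ` {n. \<exists>X. chain_to (homogeneous_submodule t) {\<zero>\<^bsub>M\<^esub>} X n})"
      using att by (intro Sup_upper) blast
  qed
qed

lemma homogeneous_submodule_set_add:
  assumes "t \<in> G" "homogeneous_submodule t X" "homogeneous_submodule t Y"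
  shows "homogeneous_submodule t (X <+>\<^bsub>M\<^esub> Y)"
proof -
  have XY: "additive_subgroup X M" "X \<subseteq> Mg t" "additive_subgroup Y M" "Y \<subseteq> Mg t"
    using assms unfolding homogeneous_submodule_def by auto
  have "r \<odot>\<^bsub>M\<^esub> z \<in> X <+>\<^bsub>M\<^esub> Y" if r: "r \<in> Rg 0" and z: "z \<in> X <+>\<^bsub>M\<^esub> Y" for r z
  proof -
    obtain x y where xy: "x \<in> X" "y \<in> Y" "z = x \<oplus>\<^bsub>M\<^esub> y" using z M.set_add_iff by blast
    have "r \<odot>\<^bsub>M\<^esub> z = r \<odot>\<^bsub>M\<^esub> x \<oplus>\<^bsub>M\<^esub> r \<odot>\<^bsub>M\<^esub> y"
      unfolding xy(3) using xy XY Mg_carrier[OF assms(1)] Rg_carrier[OF zero_G r]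
      by (intro smult_r_distr) auto
    moreover have "r \<odot>\<^bsub>M\<^esub> x \<in> X" "r \<odot>\<^bsub>M\<^esub> y \<in> Y"
      using assms xy r unfolding homogeneous_submodule_def by auto
    ultimately show ?thesis using M.set_add_iff by blast
  qed
  then show ?thesis
    unfolding homogeneous_submodule_def
    using M.add_additive_subgroups[OF XY(1,3)] M.set_add_least[OF subgroup_Mg[OF assms(1)] XY(2,4)]
    by blast
qed

lemma homogeneous_submodule_Int:
  assumes "homogeneous_submodule t X" "homogeneous_submodule t Y"
  shows "homogeneous_submodule t (X \<inter> Y)"
  using assms M.additive_subgroup_Int unfolding homogeneous_submodule_def by auto

text \<open>Write an element of \<open>Y\<close> as \<open>x + b\<close> with \<open>x\<close> in
  \<open>X\<close> and \<open>b\<close> in \<open>B\<close>. Then \<open>b\<close> lies in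
  \<open>Y \<inter> B\<close>, hence in \<open>X\<close>.\<close>

lemma additive_subgroup_modular:
  assumes X: "additive_subgroup X M" and Y: "additive_subgroup Y M" and B: "additive_subgroup B M"
    and "X \<subseteq> Y" "X \<inter> B = Y \<inter> B" "X <+>\<^bsub>M\<^esub> B = Y <+>\<^bsub>M\<^esub> B"
  shows "X = Y"
proof
  show "Y \<subseteq> X"
  proof
    fix y assume y: "y \<in> Y"
    then have "y \<in> X <+>\<^bsub>M\<^esub> B" using M.set_add_upper(1)[OF Y B] assms(6) by auto
    then obtain x b where xb: "x \<in> X" "b \<in> B" "y = x \<oplus>\<^bsub>M\<^esub> b" using M.set_add_iff by blast
    interpret X: additive_subgroup X M by fact
    interpret Y: additive_subgroup Y M by fact
    interpret B: additive_subgroup B M by fact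
    have "b = \<ominus>\<^bsub>M\<^esub> x \<oplus>\<^bsub>M\<^esub> y" unfolding xb(3)
      using xb by (simp add: M.r_neg1)
    moreover have "\<dots> \<in> Y" using xb(1) y assms(4) by auto
    ultimately have "b \<in> X" using xb(2) assms(5) by auto
    then show "y \<in> X" using xb by auto
  qed
qed fact

text \<open>Splitting a longest chain from \<open>A\<close> to \<open>C\<close> along
  \<open>B\<close> gives one inequality, gluing two longest chains at \<open>B\<close> the
  other.\<close>

lemma chain_length_additive:
  assumes t: "t \<in> G" and bd: "bounded_chains (homogeneous_submodule t)"
    and S: "homogeneous_submodule t A" "homogeneous_submodule t B" "homogeneous_submodule t C"
    and sub: "A \<subseteq> B" "B \<subseteq> C"
  shows "chain_length (homogeneous_submodule t) A C =
    chain_length (homogeneous_submodule t) A B + chain_length (homogeneous_submodule t) B C"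
proof (rule antisym)
  let ?S = "homogeneous_submodule t"
  have ag: "additive_subgroup X M" if "?S X" for X using that by (simp add: homogeneous_submodule_def)
  have "\<exists>p q. chain_length ?S A C \<le> p + q \<and> chain_to ?S A (C \<inter> B) p \<and>
      chain_to ?S B (C <+>\<^bsub>M\<^esub> B) q"
  proof (rule chain_to_split)
    show "chain_to ?S A C (chain_length ?S A C)"
      using chain_length_attained bd S sub by (meson order_trans)
    show "?S (X <+>\<^bsub>M\<^esub> B) \<and> B \<subseteq> X <+>\<^bsub>M\<^esub> B" if "?S X" for X
      using homogeneous_submodule_set_add[OF t that S(2)] M.set_add_upper(2)[OF ag ag] that S by blast
    show "X <+>\<^bsub>M\<^esub> B \<subseteq> Y <+>\<^bsub>M\<^esub> B" if "X \<subseteq> Y" for X Y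
      using that unfolding set_add_def' by blast
    show "X = Y" if "?S X" "?S Y" "X \<subseteq> Y" "X \<inter> B = Y \<inter> B" "X <+>\<^bsub>M\<^esub> B = Y <+>\<^bsub>M\<^esub> B" for X Y
      using additive_subgroup_modular that ag S by blast
  qed (use S sub homogeneous_submodule_Int in auto)
  then obtain p q where pq: "chain_length ?S A C \<le> p + q" "chain_to ?S A (C \<inter> B) p"
    "chain_to ?S B (C <+>\<^bsub>M\<^esub> B) q" by blast
  have "C \<inter> B = B" "C <+>\<^bsub>M\<^esub> B = C"
    using sub M.set_add_upper(1)[OF ag ag, of C B] S M.set_add_least[OF ag, of C C B] by auto
  then show "chain_length ?S A C \<le> chain_length ?S A B + chain_length ?S B C"
    using pq chain_length_ge[OF bd, of A B p] chain_length_ge[OF bd, of B C q] by simp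
  show "chain_length ?S A B + chain_length ?S B C \<le> chain_length ?S A C"
    using chain_length_ge[OF bd chain_to_concat[OF chain_length_attained chain_length_attained]]
      bd S sub by blast
qed

section \<open>Adjoining a homogeneous element\<close>

text \<open>The degree \<open>t\<close> part of \<open>N + R m\<close> for \<open>m\<close> of
  degree \<open>g\<close>: the scalars needed have degree \<open>t - g\<close>.\<close>

definition adjoin :: "('g \<Rightarrow> 'm set) \<Rightarrow> 'g \<Rightarrow> 'm \<Rightarrow> 'g \<Rightarrow> 'm set" where
  "adjoin N g m t = N t <+>\<^bsub>M\<^esub> (\<lambda>r. r \<odot>\<^bsub>M\<^esub> m) ` Rg (t - g)"

text \<open>The degree \<open>h\<close> part of the ideal \<open>(N : m)\<close>, with
  \<open>m\<close> of degree \<open>g\<close>.\<close>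

definition annihilator :: "('g \<Rightarrow> 'm set) \<Rightarrow> 'g \<Rightarrow> 'm \<Rightarrow> 'g \<Rightarrow> 'r set" where
  "annihilator N g m h = {r \<in> Rg h. r \<odot>\<^bsub>M\<^esub> m \<in> N (h + g)}"

lemma adjoin_iff: "z \<in> adjoin N g m t \<longleftrightarrow> (\<exists>x\<in>N t. \<exists>r\<in>Rg (t - g). z = x \<oplus>\<^bsub>M\<^esub> r \<odot>\<^bsub>M\<^esub> m)"
  unfolding adjoin_def M.set_add_iff by blast

lemma additive_subgroup_multiples:
  assumes "additive_subgroup K R" "m \<in> carrier M"
  shows "additive_subgroup ((\<lambda>r. r \<odot>\<^bsub>M\<^esub> m) ` K) M"
proof -
  interpret K: additive_subgroup K R by fact
  show ?thesis
  proof (rule M.additive_subgroupI')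
    show "\<zero>\<^bsub>M\<^esub> \<in> (\<lambda>r. r \<odot>\<^bsub>M\<^esub> m) ` K"
      using assms(2) K.zero_closed by (intro image_eqI[of _ _ \<zero>]) auto
    show "x \<oplus>\<^bsub>M\<^esub> y \<in> (\<lambda>r. r \<odot>\<^bsub>M\<^esub> m) ` K"
      if xy: "x \<in> (\<lambda>r. r \<odot>\<^bsub>M\<^esub> m) ` K" "y \<in> (\<lambda>r. r \<odot>\<^bsub>M\<^esub> m) ` K" for x y
    proof -
      obtain r s where "r \<in> K" "s \<in> K" "x = r \<odot>\<^bsub>M\<^esub> m" "y = s \<odot>\<^bsub>M\<^esub> m" using xy by auto
      then show ?thesis using assms(2)
        by (intro image_eqI[of _ _ "r \<oplus> s"]) (auto simp: smult_l_distr)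
    qed
    show "\<ominus>\<^bsub>M\<^esub> x \<in> (\<lambda>r. r \<odot>\<^bsub>M\<^esub> m) ` K" if x: "x \<in> (\<lambda>r. r \<odot>\<^bsub>M\<^esub> m) ` K" for x
    proof -
      obtain r where "r \<in> K" "x = r \<odot>\<^bsub>M\<^esub> m" using x by auto
      then show ?thesis using assms(2)
        by (intro image_eqI[of _ _ "\<ominus> r"]) (auto simp: smult_l_minus)
    qed
  qed (use assms(2) in auto)
qed

lemma additive_subgroup_adjoin:
  assumes "additive_subgroup X M" "additive_subgroup K R" "m \<in> carrier M"
  shows "additive_subgroup (X <+>\<^bsub>M\<^esub> (\<lambda>r. r \<odot>\<^bsub>M\<^esub> m) ` K) M"
  using M.add_additive_subgroups additive_subgroup_multiples assms by blast

lemma homogeneous_family_adjoin: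
  assumes N: "homogeneous_family N" and g: "g \<in> G" and m: "m \<in> Mg g"
  shows "homogeneous_family (adjoin N g m)"
  unfolding homogeneous_family_def
proof (intro conjI ballI)
  note mc = Mg_carrier[OF g m]
  fix t assume t: "t \<in> G"
  show "additive_subgroup (adjoin N g m t) M"
    unfolding adjoin_def
    using additive_subgroup_adjoin[OF homogeneous_familyD(1)[OF N t] subgroup_Rg mc] diff_G[OF t g]
    by blast
  have "r \<odot>\<^bsub>M\<^esub> m \<in> Mg t" if "r \<in> Rg (t - g)" for r
    using Mg_smult[OF diff_G[OF t g] g that m] by simp
  then show "adjoin N g m t \<subseteq> Mg t"
    unfolding adjoin_def using homogeneous_familyD(2)[OF N t]
    by (intro M.set_add_least[OF subgroup_Mg[OF t]]) auto
next
  note mc = Mg_carrier[OF g m]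
  fix h t s z assume h: "h \<in> G" and t: "t \<in> G" and s: "s \<in> Rg h" and z: "z \<in> adjoin N g m t"
  obtain x r where xr: "x \<in> N t" "r \<in> Rg (t - g)" "z = x \<oplus>\<^bsub>M\<^esub> r \<odot>\<^bsub>M\<^esub> m"
    using z adjoin_iff by blast
  have c: "s \<in> carrier R" "r \<in> carrier R" "x \<in> carrier M"
    using Rg_carrier[OF h s] Rg_carrier[OF diff_G[OF t g] xr(2)]
      homogeneous_familyD(2)[OF N t] xr(1) Mg_carrier[OF t] by auto
  have "s \<odot>\<^bsub>M\<^esub> z = s \<odot>\<^bsub>M\<^esub> x \<oplus>\<^bsub>M\<^esub> (s \<otimes> r) \<odot>\<^bsub>M\<^esub> m"
    unfolding xr(3) using c mc by (simp add: smult_r_distr smult_assoc1)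
  moreover have "s \<odot>\<^bsub>M\<^esub> x \<in> N (h + t)" using homogeneous_familyD(5)[OF N t h s xr(1)] .
  moreover have "s \<otimes> r \<in> Rg (h + t - g)"
    using Rg_mult[OF h diff_G[OF t g] s xr(2)] by (simp add: algebra_simps)
  ultimately show "s \<odot>\<^bsub>M\<^esub> z \<in> adjoin N g m (h + t)" using adjoin_iff by blast
qed

lemma adjoin_upper:
  assumes "homogeneous_family N" "g \<in> G" "m \<in> Mg g" "t \<in> G"
  shows "N t \<subseteq> adjoin N g m t"
  unfolding adjoin_def
  using M.set_add_upper(1) homogeneous_familyD(1)[OF assms(1,4)]
    additive_subgroup_multiples[OF subgroup_Rg[OF diff_G[OF assms(4,2)]] Mg_carrier[OF assms(2,3)]]
  by blast

lemma adjoin_member: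
  assumes "homogeneous_family N" "g \<in> G" "m \<in> Mg g" "h \<in> G" "r \<in> Rg h"
  shows "r \<odot>\<^bsub>M\<^esub> m \<in> adjoin N g m (h + g)"
  unfolding adjoin_iff
  using homogeneous_familyD(3)[OF assms(1) add_G[OF assms(4,2)]] assms(5)
    Rg_carrier[OF assms(4,5)] Mg_carrier[OF assms(2,3)]
  by (intro bexI[of _ "\<zero>\<^bsub>M\<^esub>"] bexI[of _ r]) auto

lemma adjoin_least:
  assumes N: "homogeneous_family N" and L: "homogeneous_family L" and g: "g \<in> G" and t: "t \<in> G"
    and "N t \<subseteq> L t" and m: "m \<in> L g"
  shows "adjoin N g m t \<subseteq> L t"
  unfolding adjoin_def
proof (rule M.set_add_least[OF homogeneous_familyD(1)[OF L t] assms(5)])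
  show "(\<lambda>r. r \<odot>\<^bsub>M\<^esub> m) ` Rg (t - g) \<subseteq> L t"
    using homogeneous_familyD(5)[OF L g diff_G[OF t g] _ m] by auto
qed

lemma adjoin_self:
  assumes "homogeneous_family N" "g \<in> G" "m \<in> Mg g"
  shows "m \<in> adjoin N g m g"
  using adjoin_member[OF assms zero_G one_homogeneous] Mg_carrier[OF assms(2,3)] by simp

text \<open>A homogeneous ideal is a graded submodule of the regular module, which is how the
  annihilator is treated here.\<close>

lemma homogeneous_family_annihilator:
  assumes N: "homogeneous_family N" and g: "g \<in> G" and m: "m \<in> Mg g"
  shows "graded_pair.homogeneous_family (regular_module R) G Rg Rg (annihilator N g m)"
proof -
  interpret reg: graded_pair R "regular_module R" G Rg Rg by (rule graded_pair_regular)
  note mc = Mg_carrier[OF g m]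
  have "additive_subgroup (annihilator N g m t) R" if t: "t \<in> G" for t
  proof -
    interpret Rt: additive_subgroup "Rg t" R using subgroup_Rg[OF t] .
    interpret Nt: additive_subgroup "N (t + g)" M using homogeneous_familyD(1)[OF N add_G[OF t g]] .
    show ?thesis
      by (rule R.additive_subgroupI')
        (auto simp: annihilator_def mc smult_l_distr smult_l_minus)
  qed
  moreover have "r \<otimes> s \<in> annihilator N g m (h + t)"
    if h: "h \<in> G" "t \<in> G" and r: "r \<in> Rg h" and s: "s \<in> annihilator N g m t" for h t r s
  proof -
    have s': "s \<in> Rg t" "s \<odot>\<^bsub>M\<^esub> m \<in> N (t + g)" using s by (auto simp: annihilator_def)
    have "(r \<otimes> s) \<odot>\<^bsub>M\<^esub> m = r \<odot>\<^bsub>M\<^esub> (s \<odot>\<^bsub>M\<^esub> m)"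
      using Rg_carrier[OF h(1) r] Rg_carrier[OF h(2) s'(1)] mc by (rule smult_assoc1)
    then show ?thesis
      using homogeneous_familyD(5)[OF N add_G[OF h(2) g] h(1) r s'(2)] Rg_mult[OF h r s'(1)]
      by (simp add: annihilator_def add.assoc)
  qed
  ultimately show ?thesis
    unfolding reg.homogeneous_family_def by (auto simp: annihilator_def)
qed

text \<open>The components are assembled into an ordinary ideal of \<open>R\<close>, to which
  Noetherian induction applies.\<close>

definition annihilator_ideal :: "('g \<Rightarrow> 'm set) \<Rightarrow> 'g \<Rightarrow> 'm \<Rightarrow> 'r set" where
  "annihilator_ideal N g m = graded_pair.total (regular_module R) G Rg (annihilator N g m)"

lemma ideal_annihilator_ideal:
  assumes N: "homogeneous_family N" and g: "g \<in> G" and m: "m \<in> Mg g"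
  shows "ideal (annihilator_ideal N g m) R"
proof -
  interpret reg: graded_pair R "regular_module R" G Rg Rg by (rule graded_pair_regular)
  note fam = homogeneous_family_annihilator[OF assms]
  have ag: "additive_subgroup (annihilator_ideal N g m) R"
    using reg.total_additive_subgroup[OF fam] by (simp add: annihilator_ideal_def)
  have l: "r \<otimes> a \<in> annihilator_ideal N g m"
    if "a \<in> annihilator_ideal N g m" "r \<in> carrier R" for a r
    using reg.total_smult[OF fam, of a r] that by (simp add: annihilator_ideal_def)
  show ?thesis
  proof (rule idealI)
    show "subgroup (annihilator_ideal N g m) (add_monoid R)"
      using ag by (simp add: additive_subgroup_def)
    show "a \<otimes> r \<in> annihilator_ideal N g m"
      if "a \<in> annihilator_ideal N g m" "r \<in> carrier R" for a r
      using l[OF that] that additive_subgroup.a_Hcarr[OF ag] by (simp add: R.m_comm)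
  qed (use l R.ring_axioms in auto)
qed

lemma annihilator_ideal_homogeneous:
  assumes "homogeneous_family N" "g \<in> G" "m \<in> Mg g" "h \<in> G" "r \<in> Rg h"
  shows "r \<in> annihilator_ideal N g m \<longleftrightarrow> r \<odot>\<^bsub>M\<^esub> m \<in> N (h + g)"
proof -
  interpret reg: graded_pair R "regular_module R" G Rg Rg by (rule graded_pair_regular)
  show ?thesis
    using reg.total_homogeneous[OF homogeneous_family_annihilator[OF assms(1-3)] assms(4,5)] assms(5)
    by (simp add: annihilator_ideal_def annihilator_def)
qed

lemma annihilator_ideal_mono:
  assumes "\<And>h r. h \<in> G \<Longrightarrow> r \<in> Rg h \<Longrightarrow> r \<odot>\<^bsub>M\<^esub> m \<in> N (h + g) \<Longrightarrow> r \<odot>\<^bsub>M\<^esub> m' \<in> N' (h + g')"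
  shows "annihilator_ideal N g m \<subseteq> annihilator_ideal N' g' m'"
proof -
  interpret reg: graded_pair R "regular_module R" G Rg Rg by (rule graded_pair_regular)
  show ?thesis
    using assms unfolding annihilator_ideal_def reg.total_def annihilator_def by auto
qed

text \<open>
  The submodules between \<open>N\<^sub>t\<close> and \<open>N\<^sub>t + R\<^sub>h m\<close> correspond to those between the annihilator of \<open>m\<close>
  modulo \<open>N\<close> and \<open>R\<^sub>h\<close>; only one direction of the transfer is needed, by symmetry.
\<close>

lemma chain_length_adjoin_le:
  assumes N: "homogeneous_family N" and g: "g \<in> G" and m: "m \<in> Mg g"
    and N': "homogeneous_family N'" and g': "g' \<in> G" and m': "m' \<in> Mg g'"
    and h: "h \<in> G" and eq: "\<And>r. r \<in> Rg h \<Longrightarrow> r \<odot>\<^bsub>M\<^esub> m \<in> N (h + g) \<longleftrightarrow> r \<odot>\<^bsub>M\<^esub> m' \<in> N' (h + g')"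
    and bd: "bounded_chains (homogeneous_submodule (h + g))"
    and bd': "bounded_chains (homogeneous_submodule (h + g'))"
  shows "chain_length (homogeneous_submodule (h + g)) (N (h + g)) (adjoin N g m (h + g)) \<le>
    chain_length (homogeneous_submodule (h + g')) (N' (h + g')) (adjoin N' g' m' (h + g'))"
proof -
  let ?S = "homogeneous_submodule (h + g)" and ?S' = "homogeneous_submodule (h + g')"
  let ?A = "N (h + g)" and ?A' = "N' (h + g')"
  let ?B = "adjoin N g m (h + g)" and ?B' = "adjoin N' g' m' (h + g')"
  \<comment> \<open>\<open>K X\<close> consists of the scalars of degree \<open>h\<close> that carry
    \<open>m\<close> into \<open>X\<close>; \<open>\<phi>\<close> applies these scalars to
    \<open>m'\<close> and adds \<open>N'\<close>, sending submodules over \<open>N\<close> to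
    submodules over \<open>N'\<close>.\<close>
  define K where "K X = {r \<in> Rg h. r \<odot>\<^bsub>M\<^esub> m \<in> X}" for X
  define \<phi> where "\<phi> X = ?A' <+>\<^bsub>M\<^esub> (\<lambda>r. r \<odot>\<^bsub>M\<^esub> m') ` K X" for X
  have hg: "h + g \<in> G" "h + g' \<in> G" using add_G h g g' by auto
  note mc = Mg_carrier[OF g m] and mc' = Mg_carrier[OF g' m']
  note NA = homogeneous_familyD[OF N hg(1)] and NA' = homogeneous_familyD[OF N' hg(2)]
  interpret A': additive_subgroup ?A' M by (rule NA')
  have \<phi>_iff: "z \<in> \<phi> X \<longleftrightarrow> (\<exists>n\<in>?A'. \<exists>r\<in>Rg h. r \<odot>\<^bsub>M\<^esub> m \<in> X \<and> z = n \<oplus>\<^bsub>M\<^esub> r \<odot>\<^bsub>M\<^esub> m')" for z X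
    unfolding \<phi>_def K_def M.set_add_iff by blast
  have agK: "additive_subgroup (K X) R" if "?S X" for X
  proof -
    interpret Rh: additive_subgroup "Rg h" R using subgroup_Rg[OF h] .
    interpret X: additive_subgroup X M using that by (simp add: homogeneous_submodule_def)
    show ?thesis
      by (rule R.additive_subgroupI') (auto simp: K_def mc smult_l_distr smult_l_minus)
  qed
  have S\<phi>: "?S' (\<phi> X) \<and> ?A' \<subseteq> \<phi> X" if X: "?S X" for X
  proof -
    have ag: "additive_subgroup (\<phi> X) M" and up: "?A' \<subseteq> \<phi> X"
      unfolding \<phi>_def
      using additive_subgroup_adjoin[OF NA'(1) agK[OF X] mc']
        M.set_add_upper(1)[OF NA'(1) additive_subgroup_multiples[OF agK[OF X] mc']] by auto
    moreover have "\<phi> X \<subseteq> Mg (h + g')"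
      unfolding \<phi>_def
      using NA'(2) Mg_smult[OF h g' _ m']
      by (intro M.set_add_least[OF subgroup_Mg[OF hg(2)]]) (auto simp: K_def)
    moreover have "s \<odot>\<^bsub>M\<^esub> z \<in> \<phi> X" if s: "s \<in> Rg 0" and z: "z \<in> \<phi> X" for s z
    proof -
      obtain n r where nr: "n \<in> ?A'" "r \<in> Rg h" "r \<odot>\<^bsub>M\<^esub> m \<in> X" "z = n \<oplus>\<^bsub>M\<^esub> r \<odot>\<^bsub>M\<^esub> m'"
        using z \<phi>_iff by blast
      have c: "s \<in> carrier R" "r \<in> carrier R" using Rg_carrier zero_G h s nr by auto
      have "s \<odot>\<^bsub>M\<^esub> z = s \<odot>\<^bsub>M\<^esub> n \<oplus>\<^bsub>M\<^esub> (s \<otimes> r) \<odot>\<^bsub>M\<^esub> m'"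
        unfolding nr(4) using c mc' nr(1) by (simp add: smult_r_distr smult_assoc1)
      moreover have "s \<odot>\<^bsub>M\<^esub> n \<in> ?A'" using NA'(5)[OF zero_G s nr(1)] by simp
      moreover have "s \<otimes> r \<in> Rg h" using Rg_mult[OF zero_G h s nr(2)] by simp
      moreover have "(s \<otimes> r) \<odot>\<^bsub>M\<^esub> m \<in> X"
        using X s nr(3) c mc by (simp add: smult_assoc1 homogeneous_submodule_def)
      ultimately show ?thesis using \<phi>_iff by blast
    qed
    ultimately show ?thesis by (simp add: homogeneous_submodule_def)
  qed
  have strict: "\<phi> Y \<subset> \<phi> Z" if SY: "?S Y" and SZ: "?S Z" and AY: "?A \<subseteq> Y" and YZ: "Y \<subset> Z"
    and ZB: "Z \<subseteq> ?B" for Y Z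
  proof -
    interpret Y: additive_subgroup Y M using SY by (simp add: homogeneous_submodule_def)
    interpret Z: additive_subgroup Z M using SZ by (simp add: homogeneous_submodule_def)
    have le: "\<phi> Y \<subseteq> \<phi> Z" using YZ \<phi>_iff by blast
    \<comment> \<open>Strictness: an element of \<open>Z\<close> outside \<open>Y\<close> gives a
      scalar \<open>r\<close> with \<open>r m\<close> in \<open>Z\<close> but not in
      \<open>Y\<close>. Then \<open>r m'\<close> separates the images. Otherwise \<open>r m'\<close>
      and some \<open>s m'\<close> with \<open>s m\<close> in \<open>Y\<close> would differ by an
      element of \<open>N'\<close>, and \<open>eq\<close> would put \<open>(r - s) m\<close> into
      \<open>N\<close>, hence \<open>r m\<close> into \<open>Y\<close>.\<close>
    obtain z where z: "z \<in> Z" "z \<notin> Y" using YZ by blast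
    then obtain n r where nr: "n \<in> ?A" "r \<in> Rg h" "z = n \<oplus>\<^bsub>M\<^esub> r \<odot>\<^bsub>M\<^esub> m"
      using ZB adjoin_iff[of z N g m "h + g"] by auto
    have rc: "r \<in> carrier R" using Rg_carrier[OF h nr(2)] .
    have nY: "n \<in> Y" and nZ: "n \<in> Z" using nr AY YZ by auto
    then have rY: "r \<odot>\<^bsub>M\<^esub> m \<notin> Y" using z nr by auto
    have "r \<odot>\<^bsub>M\<^esub> m = \<ominus>\<^bsub>M\<^esub> n \<oplus>\<^bsub>M\<^esub> z" unfolding nr(3) using nZ rc mc by (simp add: M.r_neg1)
    then have rZ: "r \<odot>\<^bsub>M\<^esub> m \<in> Z" using nZ z by auto
    have inZ: "r \<odot>\<^bsub>M\<^esub> m' \<in> \<phi> Z"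
      unfolding \<phi>_iff using rZ nr rc mc' by (intro bexI[of _ "\<zero>\<^bsub>M\<^esub>"] bexI[of _ r]) auto
    have "r \<odot>\<^bsub>M\<^esub> m' \<notin> \<phi> Y"
    proof
      assume "r \<odot>\<^bsub>M\<^esub> m' \<in> \<phi> Y"
      then obtain n' s where ns: "n' \<in> ?A'" "s \<in> Rg h" "s \<odot>\<^bsub>M\<^esub> m \<in> Y"
        "r \<odot>\<^bsub>M\<^esub> m' = n' \<oplus>\<^bsub>M\<^esub> s \<odot>\<^bsub>M\<^esub> m'" using \<phi>_iff by blast
      interpret Rh: additive_subgroup "Rg h" R using subgroup_Rg[OF h] .
      have sc: "s \<in> carrier R" using Rg_carrier[OF h ns(2)] .
      have d: "\<ominus> s \<oplus> r \<in> Rg h" using ns nr by auto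
      have "(\<ominus> s \<oplus> r) \<odot>\<^bsub>M\<^esub> m' = \<ominus>\<^bsub>M\<^esub> (s \<odot>\<^bsub>M\<^esub> m') \<oplus>\<^bsub>M\<^esub> (s \<odot>\<^bsub>M\<^esub> m' \<oplus>\<^bsub>M\<^esub> n')"
        using sc rc mc' ns(1,4) by (simp add: smult_l_distr smult_l_minus M.a_comm)
      also have "\<dots> = n'" using sc mc' ns(1) by (simp add: M.r_neg1)
      finally have "(\<ominus> s \<oplus> r) \<odot>\<^bsub>M\<^esub> m \<in> ?A" using eq[OF d] ns(1) by simp
      then have "s \<odot>\<^bsub>M\<^esub> m \<oplus>\<^bsub>M\<^esub> (\<ominus> s \<oplus> r) \<odot>\<^bsub>M\<^esub> m \<in> Y" using ns(3) AY by auto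
      moreover have "s \<odot>\<^bsub>M\<^esub> m \<oplus>\<^bsub>M\<^esub> (\<ominus> s \<oplus> r) \<odot>\<^bsub>M\<^esub> m = r \<odot>\<^bsub>M\<^esub> m"
        using sc rc mc by (simp add: smult_l_distr smult_l_minus M.r_neg2)
      ultimately show False using rY by simp
    qed
    then show ?thesis using le inZ by blast
  qed
  have SB: "?S ?B" "?S' ?B'"
    using homogeneous_family_submodule homogeneous_family_adjoin assms hg by blast+
  have "chain_to ?S ?A ?B (chain_length ?S ?A ?B)"
    using chain_length_attained[OF bd SB(1)] adjoin_upper[OF N g m hg(1)] by blast
  from chain_to_map[OF this order.refl, where S' = ?S' and A' = ?A' and \<phi> = \<phi>]
  have "chain_to ?S' ?A' (\<phi> ?B) (chain_length ?S ?A ?B)"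
    using S\<phi> strict by blast
  \<comment> \<open>The image of the top may be smaller than \<open>?B'\<close>; inclusion is
    enough, as the chain can be moved up.\<close>
  moreover have "\<phi> ?B \<subseteq> ?B'"
    using \<phi>_iff adjoin_iff[of _ N' g' m' "h + g'"] unfolding add_diff_cancel_right' by blast
  ultimately show ?thesis
    using SB(2) by (intro chain_length_ge[OF bd']) (rule chain_to_mono_top)
qed

end

section \<open>Noetherian induction\<close>

text \<open>Zorn's lemma on the counterexamples: in a Noetherian ring the union of a nonempty chain
  of ideals is one of its members, so a maximal counterexample exists, and \<open>step\<close>
  refutes it.\<close>

lemma (in noetherian_ring) ideal_noetherian_induct:
  assumes "ideal I R"
    and step: "\<And>I. ideal I R \<Longrightarrow> (\<And>J. ideal J R \<Longrightarrow> I \<subset> J \<Longrightarrow> P J) \<Longrightarrow> P I"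
  shows "P I"
proof (rule ccontr)
  assume "\<not> P I"
  let ?B = "{J. ideal J R \<and> \<not> P J}"
  have "\<exists>J\<in>?B. \<forall>X\<in>?B. J \<subseteq> X \<longrightarrow> X = J"
  proof (rule subset_Zorn_nonempty)
    show "?B \<noteq> {}" using assms(1) \<open>\<not> P I\<close> by blast
    fix C assume C: "C \<noteq> {}" "subset.chain ?B C"
    then have "subset.chain {J. ideal J R} C"
      unfolding subset.chain_def by blast
    then show "\<Union>C \<in> ?B"
      using ideal_chain_is_trivial[OF C(1)] C(2) unfolding subset.chain_def by blast
  qed
  then obtain J where J: "ideal J R" "\<not> P J" and max: "\<And>X. ideal X R \<Longrightarrow> \<not> P X \<Longrightarrow> J \<subseteq> X \<Longrightarrow> X = J"
    by blast
  have "P J" using J(1) by (rule step) (use max in blast)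
  then show False using J(2) by blast
qed

section \<open>Hilbert series of successive quotients\<close>

locale modest_pair = graded_pair R M G Rg Mg + noetherian_ring R
  for R :: "('r, 'x) ring_scheme" (structure) and M :: "('r, 'm, 'y) module_scheme" (structure)
    and G :: "(rat ^ 'd::finite) set" and Rg Mg +
  assumes bounded: "t \<in> G \<Longrightarrow> bounded_chains (homogeneous_submodule t)"
begin

text \<open>The Hilbert series of \<open>B / A\<close>, read off from chains between the components
  so that quotients never have to be formed.\<close>

definition relative_series :: "(rat ^ 'd \<Rightarrow> 'm set) \<Rightarrow> (rat ^ 'd \<Rightarrow> 'm set) \<Rightarrow> 'd laurent_series" where
  "relative_series A B =
     (\<lambda>t. if t \<in> G then int (chain_length (homogeneous_submodule t) (A t) (B t)) else 0)"

lemma relative_series_add: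
  assumes "homogeneous_family A" "homogeneous_family B" "homogeneous_family C"
    and "\<And>t. t \<in> G \<Longrightarrow> A t \<subseteq> B t" "\<And>t. t \<in> G \<Longrightarrow> B t \<subseteq> C t"
  shows "relative_series A C = (\<lambda>t. relative_series A B t + relative_series B C t)"
proof
  fix t
  show "relative_series A C t = relative_series A B t + relative_series B C t"
  proof (cases "t \<in> G")
    case True
    note S = homogeneous_family_submodule[OF _ True]
    show ?thesis
      using chain_length_additive[OF True bounded[OF True] S[OF assms(1)] S[OF assms(2)]
          S[OF assms(3)] assms(4)[OF True] assms(5)[OF True]] True
      by (simp add: relative_series_def)
  qed (simp add: relative_series_def)
qed

lemma binomial_summable_adjoin:
  assumes "homogeneous_family N" "g \<in> G" "m \<in> Mg g"
  shows "binomial_summable G (relative_series N (adjoin N g m))"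
proof -
  \<comment> \<open>The induction is on the annihilator ideal alone; \<open>N\<close>,
    \<open>g\<close> and \<open>m\<close> stay general because all of them change in the recursive
    calls.\<close>
  have "\<forall>N g m. homogeneous_family N \<longrightarrow> g \<in> G \<longrightarrow> m \<in> Mg g \<longrightarrow> annihilator_ideal N g m = I \<longrightarrow>
      binomial_summable G (relative_series N (adjoin N g m))" if "ideal I R" for I
    using that
  proof (rule ideal_noetherian_induct, intro allI impI)
    fix I N g m
    assume IH: "\<And>J. ideal J R \<Longrightarrow> I \<subset> J \<Longrightarrow>
        \<forall>N g m. homogeneous_family N \<longrightarrow> g \<in> G \<longrightarrow> m \<in> Mg g \<longrightarrow> annihilator_ideal N g m = J \<longrightarrow>
          binomial_summable G (relative_series N (adjoin N g m))"
      and N: "homogeneous_family N" and g: "g \<in> G" and m: "m \<in> Mg g"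
      and I: "annihilator_ideal N g m = I"
    have IH': "binomial_summable G (relative_series N' (adjoin N' g' m'))"
      if "homogeneous_family N'" "g' \<in> G" "m' \<in> Mg g'" "I \<subset> annihilator_ideal N' g' m'" for N' g' m'
      using IH[OF ideal_annihilator_ideal[OF that(1-3)] that(4)] that by blast
    note mc = Mg_carrier[OF g m]
    let ?N2 = "adjoin N g m"
    note fam2 = homogeneous_family_adjoin[OF N g m]
    show "binomial_summable G (relative_series N ?N2)"
    proof (cases "\<forall>v\<in>G - {0}. \<forall>a\<in>Rg v. a \<odot>\<^bsub>M\<^esub> m \<in> N (v + g)")
      case True
      \<comment> \<open>Every multiple of \<open>m\<close> by a scalar of nonzero degree is already
        in \<open>N\<close>, so only degree \<open>g\<close> can contribute.\<close>
      have "relative_series N ?N2 t = 0" if "t \<noteq> g" for t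
      proof (cases "t \<in> G")
        case tG: True
        have "(\<lambda>r. r \<odot>\<^bsub>M\<^esub> m) ` Rg (t - g) \<subseteq> N t"
          using True[rule_format, of "t - g"] diff_G[OF tG g] that by auto
        then have "?N2 t \<subseteq> N t"
          unfolding adjoin_def by (intro M.set_add_least homogeneous_familyD(1)[OF N tG]) auto
        then have "?N2 t = N t" using adjoin_upper[OF N g m tG] by blast
        then show ?thesis
          using chain_length_refl[OF bounded[OF tG] homogeneous_family_submodule[OF N tG]]
          by (simp add: relative_series_def)
      qed (simp add: relative_series_def)
      then show ?thesis by (rule binomial_summable_point)
    next
      case False
      then obtain v a where v: "v \<in> G" "v \<noteq> 0" and a: "a \<in> Rg v" "a \<odot>\<^bsub>M\<^esub> m \<notin> N (v + g)" by blast
      let ?b = "a \<odot>\<^bsub>M\<^esub> m"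
      let ?N1 = "adjoin N (v + g) ?b"
      have ac: "a \<in> carrier R" using Rg_carrier[OF v(1) a(1)] .
      have g1: "v + g \<in> G" using add_G v g by blast
      have b: "?b \<in> Mg (v + g)" using Mg_smult[OF v(1) g a(1) m] .
      note fam1 = homogeneous_family_adjoin[OF N g1 b]
      have N1: "N t \<subseteq> ?N1 t" if "t \<in> G" for t by (rule adjoin_upper[OF N g1 b that])
      have N2: "?N1 t \<subseteq> ?N2 t" if "t \<in> G" for t
        using adjoin_least[OF N fam2 g1 that adjoin_upper[OF N g m that] adjoin_member[OF N g m v(1) a(1)]] .
      \<comment> \<open>Since \<open>a m\<close> is a multiple of \<open>m\<close>, adjoining
        \<open>m\<close> to \<open>N + R a m\<close> gives \<open>N + R m\<close> again; the upper
        quotient thus has the form required by the induction hypothesis.\<close>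
      have top: "adjoin ?N1 g m t = ?N2 t" if t: "t \<in> G" for t
      proof
        show "adjoin ?N1 g m t \<subseteq> ?N2 t"
          using adjoin_least[OF fam1 fam2 g t N2[OF t] adjoin_self[OF N g m]] .
        show "?N2 t \<subseteq> adjoin ?N1 g m t"
          using adjoin_least[OF N homogeneous_family_adjoin[OF fam1 g m] g t _ adjoin_self[OF fam1 g m]]
            N1[OF t] adjoin_upper[OF fam1 g m t] by blast
      qed
      \<comment> \<open>The scalar \<open>a\<close> witnesses strict growth of the ideal: it carries
        \<open>m\<close> into \<open>?N1\<close> but not into \<open>N\<close>.\<close>
      have upper: "binomial_summable G (relative_series ?N1 ?N2)"
      proof -
        have "I \<subseteq> annihilator_ideal ?N1 g m"
          unfolding I[symmetric] by (rule annihilator_ideal_mono) (use N1 add_G g in blast)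
        moreover have "a \<notin> I"
          using annihilator_ideal_homogeneous[OF N g m v(1) a(1)] a(2) I by simp
        moreover have "a \<in> annihilator_ideal ?N1 g m"
          using annihilator_ideal_homogeneous[OF fam1 g m v(1) a(1)] adjoin_self[OF N g1 b] by simp
        ultimately have "I \<subset> annihilator_ideal ?N1 g m" by blast
        then have "binomial_summable G (relative_series ?N1 (adjoin ?N1 g m))"
          by (rule IH'[OF fam1 g m])
        moreover have "relative_series ?N1 (adjoin ?N1 g m) = relative_series ?N1 ?N2"
          by (auto simp: relative_series_def top)
        ultimately show ?thesis by simp
      qed
      have sum: "relative_series N ?N2 = (\<lambda>t. relative_series N ?N1 t + relative_series ?N1 ?N2 t)"
        using N1 N2 by (intro relative_series_add N fam1 fam2)
      have le: "I \<subseteq> annihilator_ideal N (v + g) ?b"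
        unfolding I[symmetric]
      proof (rule annihilator_ideal_mono)
        fix h r assume h: "h \<in> G" and r: "r \<in> Rg h" "r \<odot>\<^bsub>M\<^esub> m \<in> N (h + g)"
        have rc: "r \<in> carrier R" using Rg_carrier[OF h r(1)] .
        have "r \<odot>\<^bsub>M\<^esub> ?b = a \<odot>\<^bsub>M\<^esub> (r \<odot>\<^bsub>M\<^esub> m)"
          using rc ac mc by (simp add: R.m_comm flip: smult_assoc1)
        moreover have "\<dots> \<in> N (v + (h + g))"
          using homogeneous_familyD(5)[OF N add_G[OF h g] v(1) a(1) r(2)] .
        ultimately show "r \<odot>\<^bsub>M\<^esub> ?b \<in> N (h + (v + g))" by (simp add: add_ac)
      qed
      show ?thesis
      proof (cases "I = annihilator_ideal N (v + g) ?b")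
        case False
        then have "binomial_summable G (relative_series N ?N1)"
          using le by (intro IH' N g1 b) auto
        then show ?thesis unfolding sum using upper by (rule binomial_summable_add)
      next
        case True
        have eq: "r \<odot>\<^bsub>M\<^esub> m \<in> N (h + g) \<longleftrightarrow> r \<odot>\<^bsub>M\<^esub> ?b \<in> N (h + (v + g))"
          if "h \<in> G" "r \<in> Rg h" for h r
          using annihilator_ideal_homogeneous[OF N g m that]
            annihilator_ideal_homogeneous[OF N g1 b that] True I by simp
        \<comment> \<open>Equal annihilators make the two quotients of \<open>R\<close> the same,
          and the generators differ in degree by \<open>v\<close>. So \<open>N + R a m\<close> over
          \<open>N\<close> is \<open>N + R m\<close> over \<open>N\<close> shifted by
          \<open>v\<close>.\<close>
        have "relative_series N ?N1 t = relative_series N ?N2 (t - v)" for t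
        proof (cases "t \<in> G")
          case tG: True
          \<comment> \<open>The common degree of the scalars: they send \<open>?b\<close> to degree
            \<open>t\<close> and \<open>m\<close> to degree \<open>t - v\<close>.\<close>
          let ?h = "t - (v + g)"
          have h: "?h \<in> G" using diff_G[OF tG g1] .
          have bd: "bounded_chains (homogeneous_submodule (?h + g))"
            "bounded_chains (homogeneous_submodule (?h + (v + g)))"
            by (rule bounded[OF add_G[OF h g]], rule bounded[OF add_G[OF h g1]])
          have "?h + g = t - v" "?h + (v + g) = t" by auto
          moreover have "chain_length (homogeneous_submodule (?h + g)) (N (?h + g)) (?N2 (?h + g)) =
            chain_length (homogeneous_submodule (?h + (v + g))) (N (?h + (v + g))) (?N1 (?h + (v + g)))"
            using chain_length_adjoin_le[OF N g m N g1 b h eq[OF h] bd]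
              chain_length_adjoin_le[OF N g1 b N g m h eq[OF h, symmetric] bd(2,1)]
            by (rule antisym)
          ultimately show ?thesis
            using tG diff_G[OF tG v(1)] by (simp add: relative_series_def)
        next
          case False
          then have "t - v \<notin> G" using add_G[of "t - v" v] v(1) by auto
          then show ?thesis using False by (simp add: relative_series_def)
        qed
        \<comment> \<open>Substituting the shift into \<open>sum\<close> leaves the upper quotient
          as the effect of \<open>1 - zpow v\<close> on the whole series.\<close>
        then have "relative_series N ?N2 t - relative_series N ?N2 (t - v) = relative_series ?N1 ?N2 t" for t
          using fun_cong[OF sum, of t] by simp
        then have "binomial_summable G (\<lambda>t. relative_series N ?N2 t - relative_series N ?N2 (t - v))"
          using upper by simp
        then show ?thesis by (rule binomial_summable_shift_diff[OF v])
      qed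
    qed
  qed
  then show ?thesis using ideal_annihilator_ideal[OF assms] assms by blast
qed

lemma homogeneous_family_zero: "homogeneous_family (\<lambda>t. {\<zero>\<^bsub>M\<^esub>})"
proof -
  have "additive_subgroup {\<zero>\<^bsub>M\<^esub>} M" by (rule M.additive_subgroupI') auto
  then show ?thesis
    unfolding homogeneous_family_def
    using additive_subgroup.zero_closed[OF subgroup_Mg] Rg_carrier by auto
qed

text \<open>Homogeneous generators are adjoined one by one, and the series of the successive
  quotients add up. Each generator is stored together with its degree.\<close>

lemma exists_generated_family:
  assumes "finite H" "\<And>g m. (g, m) \<in> H \<Longrightarrow> g \<in> G \<and> m \<in> Mg g"
  shows "\<exists>N. homogeneous_family N \<and> (\<forall>(g, m)\<in>H. m \<in> N g) \<and>
    binomial_summable G (relative_series (\<lambda>t. {\<zero>\<^bsub>M\<^esub>}) N)"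
  using assms
proof (induction H rule: finite_induct)
  case empty
  have "relative_series (\<lambda>t. {\<zero>\<^bsub>M\<^esub>}) (\<lambda>t. {\<zero>\<^bsub>M\<^esub>}) t = 0" for t
    using chain_length_refl[OF bounded homogeneous_family_submodule[OF homogeneous_family_zero]]
    by (simp add: relative_series_def)
  then show ?case
    using homogeneous_family_zero by (intro exI[of _ "\<lambda>t. {\<zero>\<^bsub>M\<^esub>}"]) (auto intro: binomial_summable_point)
next
  case (insert gm H)
  obtain g m where gm: "gm = (g, m)" by fastforce
  obtain N where N: "homogeneous_family N" "\<forall>(g, m)\<in>H. m \<in> N g"
    "binomial_summable G (relative_series (\<lambda>t. {\<zero>\<^bsub>M\<^esub>}) N)"
    using insert.IH insert.prems by blast
  have g: "g \<in> G" and m: "m \<in> Mg g" using insert.prems gm by auto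
  note fam = homogeneous_family_adjoin[OF N(1) g m]
  note up = adjoin_upper[OF N(1) g m]
  have "relative_series (\<lambda>t. {\<zero>\<^bsub>M\<^esub>}) (adjoin N g m) =
      (\<lambda>t. relative_series (\<lambda>t. {\<zero>\<^bsub>M\<^esub>}) N t + relative_series N (adjoin N g m) t)"
    using homogeneous_familyD(3)[OF N(1)] up
    by (intro relative_series_add homogeneous_family_zero N fam) auto
  then have "binomial_summable G (relative_series (\<lambda>t. {\<zero>\<^bsub>M\<^esub>}) (adjoin N g m))"
    using binomial_summable_add[OF N(3) binomial_summable_adjoin[OF N(1) g m]] by simp
  moreover have "\<forall>(g', m')\<in>insert gm H. m' \<in> adjoin N g m g'"
  proof (clarify, elim insertE)
    fix g' m' assume "(g', m') = gm"
    then show "m' \<in> adjoin N g m g'" using adjoin_self[OF N(1) g m] gm by simp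
  next
    fix g' m' assume "(g', m') \<in> H"
    then show "m' \<in> adjoin N g m g'" using N(2) up[of g'] insert.prems by blast
  qed
  ultimately show ?case using fam by blast
qed

lemma binomial_summable_module:
  assumes "finitely_generated_module R M"
  shows "binomial_summable G (relative_series (\<lambda>t. {\<zero>\<^bsub>M\<^esub>}) Mg)"
proof -
  obtain S where S: "finite S" "S \<subseteq> carrier M"
    and gen: "\<And>x. x \<in> carrier M \<Longrightarrow> \<exists>a\<in>S \<rightarrow> carrier R. x = (\<Oplus>\<^bsub>M\<^esub>s\<in>S. a s \<odot>\<^bsub>M\<^esub> s)"
    using assms unfolding finitely_generated_module_def by blast
  \<comment> \<open>The nonzero homogeneous parts of the given generators, which generate
    \<open>M\<close> as well.\<close>
  define H where "H = (\<Union>s\<in>S. (\<lambda>g. (g, cM s g)) ` {g. cM s g \<noteq> \<zero>\<^bsub>M\<^esub>})"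
  have "finite H"
    unfolding H_def using S component_props(3)[OF ds_M] by blast
  moreover have "g \<in> G \<and> m \<in> Mg g" if gm: "(g, m) \<in> H" for g m
  proof -
    obtain s where s: "s \<in> carrier M" "cM s g \<noteq> \<zero>\<^bsub>M\<^esub>" "m = cM s g"
      using gm S(2) unfolding H_def by blast
    then have "g \<in> G" using component_props(2)[OF ds_M s(1)] by blast
    then show ?thesis using component_props(1)[OF ds_M s(1)] s(3) by blast
  qed
  ultimately obtain N where N: "homogeneous_family N" "\<forall>(g, m)\<in>H. m \<in> N g"
    "binomial_summable G (relative_series (\<lambda>t. {\<zero>\<^bsub>M\<^esub>}) N)"
    using exists_generated_family by blast
  have S_total: "s \<in> total N" if s: "s \<in> S" for s
  proof -
    have "cM s t \<in> N t" if t: "t \<in> G" for t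
    proof (cases "cM s t = \<zero>\<^bsub>M\<^esub>")
      case True
      then show ?thesis using homogeneous_familyD(3)[OF N(1) t] by simp
    next
      case False
      then have "(t, cM s t) \<in> H" unfolding H_def using s by blast
      then show ?thesis using N(2) by blast
    qed
    then show ?thesis using s S(2) unfolding total_def by blast
  qed
  \<comment> \<open>All generators lie in \<open>total N\<close>, hence so does every element of
    \<open>M\<close>; for a homogeneous one this means membership in its component of
    \<open>N\<close>.\<close>
  have "N t = Mg t" if t: "t \<in> G" for t
  proof
    show "N t \<subseteq> Mg t" using homogeneous_familyD(2)[OF N(1) t] .
    show "Mg t \<subseteq> N t"
    proof
      fix x assume x: "x \<in> Mg t"
      obtain a where a: "a \<in> S \<rightarrow> carrier R" "x = (\<Oplus>\<^bsub>M\<^esub>s\<in>S. a s \<odot>\<^bsub>M\<^esub> s)"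
        using gen[OF Mg_carrier[OF t x]] by blast
      have "x \<in> total N" unfolding a(2)
        using a(1) by (intro total_finsum[OF N(1) S(1)] total_smult[OF N(1)] S_total) auto
      then show "x \<in> N t" using total_homogeneous[OF N(1) t x] by blast
    qed
  qed
  then have "relative_series (\<lambda>t. {\<zero>\<^bsub>M\<^esub>}) Mg = relative_series (\<lambda>t. {\<zero>\<^bsub>M\<^esub>}) N"
    by (auto simp: relative_series_def)
  then show ?thesis using N(3) by simp
qed

end

theorem theorem7p10:
  fixes G :: "(rat ^ 'd::finite) set"
    and R :: "('r, 'x) ring_scheme"
    and Rg :: "rat ^ 'd \<Rightarrow> 'r set"
    and M :: "('r, 'm, 'y) module_scheme"
    and Mg :: "rat ^ 'd \<Rightarrow> 'm set"
  assumes "subgroup G rat_vec_group"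
    and "graded_ring G R Rg"
    and "noetherian_ring R"
    and "graded_module G R Rg M Mg"
    and "finitely_generated_module R M"
    and "modest G R Rg M Mg"
  shows "(\<exists>(s::nat) v. (\<forall>i<s. v i \<in> G \<and> v i \<noteq> 0) \<and>
            is_laurent_poly (act (\<Prod>i<s. 1 - zpow (v i)) (hilbert_series G R Rg M Mg)))
         \<and> summable_series (hilbert_series G R Rg M Mg)"
proof -
  interpret sub: subgroup G "rat_vec_group :: (rat ^ 'd) monoid" by fact
  have add: "g + h \<in> G" if "g \<in> G" "h \<in> G" for g h
    using sub.m_closed[OF that] by (simp add: rat_vec_group_def)
  have zero: "0 \<in> G" using sub.one_closed by (simp add: rat_vec_group_def)
  have uminus: "- g \<in> G" if "g \<in> G" for g
  proof -
    \<comment> \<open>The inverse in the monoid record must be identified with unary minus.\<close>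
    have "group (rat_vec_group :: (rat ^ 'd) monoid)"
      by (rule groupI) (auto simp: rat_vec_group_def add.assoc intro: exI[of _ "- _"])
    then have "inv\<^bsub>rat_vec_group\<^esub> g = - g"
      by (rule group.inv_equality) (auto simp: rat_vec_group_def)
    then show ?thesis using sub.m_inv_closed[OF that] by simp
  qed
  interpret graded_pair R M G Rg Mg
    using assms(2,4) zero add uminus
    by (simp add: graded_pair_def graded_pair_axioms_def graded_module_def)
  have modest: "component_length R Rg M Mg t \<noteq> \<infinity>" if "t \<in> G" for t
    using assms(6) that by (simp add: modest_def)
  interpret modest_pair R M G Rg Mg
    using graded_pair_axioms assms(3) bounded_chains_homogeneous modest
    by (simp add: modest_pair_def modest_pair_axioms_def)
  \<comment> \<open>Modesty makes each length finite, so \<open>the_enat\<close> returns the chain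
    length from zero to \<open>Mg t\<close>.\<close>
  have "hilbert_series G R Rg M Mg = relative_series (\<lambda>t. {\<zero>\<^bsub>M\<^esub>}) Mg"
    using component_length_eq_chain_length modest
    by (auto simp: hilbert_series_def relative_series_def)
  then have bs: "binomial_summable G (hilbert_series G R Rg M Mg)"
    using binomial_summable_module[OF assms(5)] by simp
  then obtain vs where vs: "set vs \<subseteq> G - {0}"
    "is_laurent_poly (act (binomials vs) (hilbert_series G R Rg M Mg))"
    unfolding binomial_summable_def by blast
  \<comment> \<open>The list of exponents becomes the indexed family of the statement, with
    \<open>s\<close> the length of the list.\<close>
  have "binomials vs = (\<Prod>i<length vs. 1 - zpow (vs ! i))"
    unfolding binomials_def prod.list_conv_set_nth by (simp add: atLeast0LessThan)
  moreover have "\<forall>i<length vs. vs ! i \<in> G \<and> vs ! i \<noteq> 0"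
    using vs(1) nth_mem by fastforce
  ultimately show ?thesis
    using vs(2) binomial_summable_imp_summable[OF bs] by metis
qed

end
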